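(* Let $G$ be an almost abelian Lie group of dimension $n$, $\mathfrak g$ its Lie algebra and $\mathfrak u\subset\mathfrak g$ an abelian ideal of codimension one. Assume that, for $Y\in\mathfrak g\setminus\mathfrak u$, the endomorphism $\mathrm{ad}(Y)|_{\mathfrak u}$ is not nilpotent, and that either $\dim G\le 4$ or $\mathrm{ad}(Y)|_{\mathfrak u}=\lambda\,\mathrm{id}_{\mathfrak u}$ for some $\lambda\in\mathbb R$. Let $F\in\mathbb R^{(n-1)\times(n-1)}$ be the matrix of $\mathrm{ad}(X_n)|_{\mathfrak u}$ with respect to $(X_1,\dots,X_{n-1})$, where $(X_1,\dots,X_n)$ is a basis of $\mathfrak g$ such that $(X_1,\dots,X_{n-1})$ is a basis of $\mathfrak u$ and $X_n$ is orthogonal to $\mathfrak u$ for the initial metric. Let $(H_t,h_t)_{t\in(T_-,T_+)}$, with $T_-,T_+\in\mathbb R\cup\{-\infty,\infty\}$, $H_t\in\mathrm{Sym}_+(n-1,\mathbb R)$ and $h_t\in(0,\infty)$, be the maximal solution of the initial value problem (with initial values prescribed at $t=0$) corresponding to either the homogeneous spinor flow $$\dot H_t=-\tfrac{1}{64h_t}\bigl(H_t(3\,\mathrm{tr}(H_tFH_t^{-1}F^T)+\mathrm{tr}(F^2))+6H_tFH_t^{-1}F^TH_t-6F^TH_tF\bigr),\quad \dot h_t=\tfrac{1}{64}\bigl(3\,\mathrm{tr}(H_tFH_t^{-1}F^T)+\mathrm{tr}(F^2)\bigr),$$ or the volume-normalized homogeneous spinor flow $$\dot H_t=-\tfrac{1}{64h_t}\bigl(\tfrac2nH_t(3\,\mathrm{tr}(H_tFH_t^{-1}F^T)+\mathrm{tr}(F^2))+6H_tFH_t^{-1}F^TH_t-6F^TH_tF\bigr),\quad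 \dot h_t=\tfrac{n-1}{32n}\bigl(3\,\mathrm{tr}(H_tFH_t^{-1}F^T)+\mathrm{tr}(F^2)\bigr).$$ Then $T_-$ is finite, i.e. $T_-\in\mathbb R$, and $\lim_{t\searrow T_-}h_t=0$ and $\lim_{t\searrow T_-}\det(H_t)=\infty$. Moreover, $\lim_{t\nearrow T_+}h_t=\infty$ and $\lim_{t\nearrow T_+}\det(H_t)=0$.
   Context: Throughout $n\ge 3$. A Lie group is almost abelian if its Lie algebra $\mathfrak g$ has a codimension-one abelian ideal $\mathfrak u$; for $Y,Y'\in\mathfrak g\setminus\mathfrak u$ the endomorphisms $\mathrm{ad}(Y)|_{\mathfrak u}$ and $\mathrm{ad}(Y')|_{\mathfrak u}$ are nonzero multiples of each other. $\mathrm{Sym}_+(m,\mathbb R)$ is the set of real symmetric positive definite $m\times m$ matrices. Here the pair $(H_t,h_t)$ represents the left-invariant metric $g_t=\begin{pmatrix}H_t&0\\0&h_t\end{pmatrix}$ on $\mathfrak g$ with respect to the basis $(X_1,\dots,X_n)$. Under the hypotheses on $\mathfrak g$, the homogeneous spinor flow (respectively its volume-normalized version), the negative gradient flow of the spinorial energy $\frac12\int|\nabla^g\varphi|^2\mathrm{vol}_g$ on left-invariant pairs of metrics and unit spinors (respectively its volume-constrained version), evolves only the metric, and the metric evolves by the stated ODE systems. *)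

theory Defs
  imports
    "HOL-Analysis.Analysis"
    "HOL-Algebra.Group"
    "HOL-Library.Function_Algebras"
begin

section \<open>Lie groups\<close>

text \<open>Only meant for open \<open>S\<close>: all iterated directional derivatives up to order \<open>k\<close> exist
  and are continuous.\<close>

fun Ck_on :: "nat \<Rightarrow> 'a::euclidean_space set \<Rightarrow> ('a \<Rightarrow> 'b::real_normed_vector) \<Rightarrow> bool" where
  "Ck_on 0 S f \<longleftrightarrow> continuous_on S f"
| "Ck_on (Suc k) S f \<longleftrightarrow>
     (\<forall>x\<in>S. f differentiable (at x)) \<and> (\<forall>v. Ck_on k S (\<lambda>x. frechet_derivative f (at x) v))"

definition smooth_on :: "'a::euclidean_space set \<Rightarrow> ('a \<Rightarrow> 'b::real_normed_vector) \<Rightarrow> bool" where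
  "smooth_on S f \<longleftrightarrow> (\<forall>k. Ck_on k S f)"

type_synonym ('g, 'e) atlas = "('g set \<times> ('g \<Rightarrow> 'e)) set"

text \<open>The atlas need not be maximal.\<close>

definition smooth_manifold :: "'g topology \<Rightarrow> ('g, 'e::euclidean_space) atlas \<Rightarrow> bool" where
  "smooth_manifold T A \<longleftrightarrow>
     Hausdorff_space T \<and> second_countable T \<and>
     (\<Union>(U, \<phi>)\<in>A. U) = topspace T \<and>
     (\<forall>(U, \<phi>)\<in>A. openin T U \<and> open (\<phi> ` U) \<and>
        homeomorphic_map (subtopology T U) (top_of_set (\<phi> ` U)) \<phi>) \<and>
     (\<forall>(U, \<phi>)\<in>A. \<forall>(V, \<psi>)\<in>A. smooth_on (\<phi> ` (U \<inter> V)) (\<psi> \<circ> inv_into U \<phi>))"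

definition smooth_map ::
  "'g topology \<Rightarrow> ('g, 'e::euclidean_space) atlas \<Rightarrow>
   'h topology \<Rightarrow> ('h, 'f::euclidean_space) atlas \<Rightarrow> ('g \<Rightarrow> 'h) \<Rightarrow> bool" where
  "smooth_map T A T' A' f \<longleftrightarrow>
     continuous_map T T' f \<and>
     (\<forall>(U, \<phi>)\<in>A. \<forall>(V, \<psi>)\<in>A'.
        smooth_on (\<phi> ` {x\<in>U. f x \<in> V}) (\<psi> \<circ> f \<circ> inv_into U \<phi>))"

definition prod_atlas ::
  "('g, 'e) atlas \<Rightarrow> ('h, 'f) atlas \<Rightarrow> ('g \<times> 'h, 'e \<times> 'f) atlas" where
  "prod_atlas A B = {(U \<times> V, map_prod \<phi> \<psi>) | U \<phi> V \<psi>. (U, \<phi>) \<in> A \<and> (V, \<psi>) \<in> B}"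

record ('g, 'e) lie_structure = "'g monoid" +
  topology_of :: "'g topology"
  atlas_of :: "('g, 'e) atlas"

text \<open>The dimension of the Lie group is \<open>DIM('e)\<close>.\<close>

definition lie_group :: "('g, 'e::euclidean_space) lie_structure \<Rightarrow> bool" where
  "lie_group G \<longleftrightarrow>
     group G \<and> topspace (topology_of G) = carrier G \<and>
     smooth_manifold (topology_of G) (atlas_of G) \<and>
     smooth_map (prod_topology (topology_of G) (topology_of G)) (prod_atlas (atlas_of G) (atlas_of G))
       (topology_of G) (atlas_of G) (\<lambda>(a, b). a \<otimes>\<^bsub>G\<^esub> b) \<and>
     smooth_map (topology_of G) (atlas_of G) (topology_of G) (atlas_of G) (\<lambda>a. inv\<^bsub>G\<^esub> a)"


section \<open>The Lie algebra of a Lie group\<close>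

text \<open>Pointwise real vector space structure on functions. Operators on functions thereby form a
  real vector space too, so that \<open>subspace\<close>, \<open>independent\<close>, \<open>span\<close> and \<open>dim\<close> apply to vector fields.\<close>

instantiation "fun" :: (type, real_vector) real_vector
begin

definition scaleR_fun :: "real \<Rightarrow> ('a \<Rightarrow> 'b) \<Rightarrow> 'a \<Rightarrow> 'b" where
  "scaleR_fun c f = (\<lambda>x. c *\<^sub>R f x)"

instance
  by standard (simp_all add: scaleR_fun_def fun_eq_iff algebra_simps)

end

text \<open>Functions on the manifold are represented by functions vanishing outside the carrier.\<close>

definition smooth_functions :: "('g, 'e::euclidean_space) lie_structure \<Rightarrow> ('g \<Rightarrow> real) set" where
  "smooth_functions G =
     {f. smooth_map (topology_of G) (atlas_of G) euclidean {(UNIV, id)} f \<and>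
         (\<forall>x. x \<notin> carrier G \<longrightarrow> f x = 0)}"

type_synonym 'g vector_field = "('g \<Rightarrow> real) \<Rightarrow> ('g \<Rightarrow> real)"

text \<open>Smooth vector fields are identified with the derivations of the algebra of smooth functions;
  as total functions, they vanish on functions that are not smooth.\<close>

definition vector_fields :: "('g, 'e::euclidean_space) lie_structure \<Rightarrow> 'g vector_field set" where
  "vector_fields G =
     {D. (\<forall>f\<in>smooth_functions G. D f \<in> smooth_functions G) \<and>
         (\<forall>f. f \<notin> smooth_functions G \<longrightarrow> D f = 0) \<and>
         (\<forall>f\<in>smooth_functions G. \<forall>g\<in>smooth_functions G. D (f + g) = D f + D g) \<and>
         (\<forall>f\<in>smooth_functions G. \<forall>c::real. D (c *\<^sub>R f) = c *\<^sub>R D f) \<and>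
         (\<forall>f\<in>smooth_functions G. \<forall>g\<in>smooth_functions G. D (f * g) = f * D g + D f * g)}"

definition left_translate ::
  "('g, 'e) lie_structure \<Rightarrow> 'g \<Rightarrow> ('g \<Rightarrow> real) \<Rightarrow> ('g \<Rightarrow> real)" where
  "left_translate G a f = (\<lambda>x. if x \<in> carrier G then f (a \<otimes>\<^bsub>G\<^esub> x) else 0)"

definition lie_algebra :: "('g, 'e::euclidean_space) lie_structure \<Rightarrow> 'g vector_field set" where
  "lie_algebra G =
     {D \<in> vector_fields G. \<forall>a\<in>carrier G. \<forall>f\<in>smooth_functions G.
        D (left_translate G a f) = left_translate G a (D f)}"

definition lie_bracket :: "'g vector_field \<Rightarrow> 'g vector_field \<Rightarrow> 'g vector_field" where
  "lie_bracket X Y = (\<lambda>f. X (Y f) - Y (X f))"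

definition codim1_abelian_ideal ::
  "'g vector_field set \<Rightarrow> 'g vector_field set \<Rightarrow> bool" where
  "codim1_abelian_ideal \<uu> \<gg> \<longleftrightarrow>
     subspace \<uu> \<and> \<uu> \<subseteq> \<gg> \<and> dim \<gg> = dim \<uu> + 1 \<and>
     (\<forall>X\<in>\<gg>. \<forall>U\<in>\<uu>. lie_bracket X U \<in> \<uu>) \<and>
     (\<forall>U\<in>\<uu>. \<forall>V\<in>\<uu>. lie_bracket U V = 0)"

definition almost_abelian :: "('g, 'e::euclidean_space) lie_structure \<Rightarrow> bool" where
  "almost_abelian G \<longleftrightarrow> (\<exists>\<uu>. codim1_abelian_ideal \<uu> (lie_algebra G))"

definition nilpotent_on :: "'v::zero set \<Rightarrow> ('v \<Rightarrow> 'v) \<Rightarrow> bool" where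
  "nilpotent_on V f \<longleftrightarrow> (\<exists>k. \<forall>v\<in>V. (f ^^ k) v = 0)"

definition basis_family :: "('i \<Rightarrow> 'v::real_vector) \<Rightarrow> 'v set \<Rightarrow> bool" where
  "basis_family X V \<longleftrightarrow> inj X \<and> independent (range X) \<and> span (range X) = V"

text \<open>Left-invariant metrics are inner products on the Lie algebra.\<close>

definition inner_product_on :: "'v::real_vector set \<Rightarrow> ('v \<Rightarrow> 'v \<Rightarrow> real) \<Rightarrow> bool" where
  "inner_product_on V g \<longleftrightarrow>
     (\<forall>x\<in>V. \<forall>y\<in>V. g x y = g y x) \<and>
     (\<forall>x\<in>V. \<forall>y\<in>V. \<forall>z\<in>V. \<forall>a b. g (a *\<^sub>R x + b *\<^sub>R y) z = a * g x z + b * g y z) \<and>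
     (\<forall>x\<in>V. x \<noteq> 0 \<longrightarrow> g x x > 0)"


section \<open>The homogeneous spinor flow\<close>

definition Sym_plus :: "(real^'m^'m) set" where
  "Sym_plus = {A. transpose A = A \<and> (\<forall>v. v \<noteq> 0 \<longrightarrow> v \<bullet> (A *v v) > 0)}"

definition flow_scalar :: "real^'m^'m \<Rightarrow> real^'m^'m \<Rightarrow> real" where
  "flow_scalar F H =
     3 * trace (H ** F ** matrix_inv H ** transpose F) + trace (F ** F)"

definition flow_tensor :: "real^'m^'m \<Rightarrow> real^'m^'m \<Rightarrow> real^'m^'m" where
  "flow_tensor F H =
     6 *\<^sub>R (H ** F ** matrix_inv H ** transpose F ** H) - 6 *\<^sub>R (transpose F ** H ** F)"

definition spinor_flow :: "real^'m^'m \<Rightarrow> (real^'m^'m) \<times> real \<Rightarrow> (real^'m^'m) \<times> real" where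
  "spinor_flow F = (\<lambda>(H, h).
     (- (1 / (64 * h)) *\<^sub>R (flow_scalar F H *\<^sub>R H + flow_tensor F H),
      1 / 64 * flow_scalar F H))"

definition normalized_spinor_flow ::
  "nat \<Rightarrow> real^'m^'m \<Rightarrow> (real^'m^'m) \<times> real \<Rightarrow> (real^'m^'m) \<times> real" where
  "normalized_spinor_flow n F = (\<lambda>(H, h).
     (- (1 / (64 * h)) *\<^sub>R ((2 / real n * flow_scalar F H) *\<^sub>R H + flow_tensor F H),
      (real n - 1) / (32 * real n) * flow_scalar F H))"

text \<open>Solutions, with values in \<open>Sym_plus \<times> {0<..}\<close>, of the autonomous system with right-hand side
  \<open>R\<close> on the open interval \<open>(a, b)\<close> containing \<open>0\<close>.\<close>

definition solves_ivp ::
  "((real^'m^'m) \<times> real \<Rightarrow> (real^'m^'m) \<times> real) \<Rightarrow> (real^'m^'m) \<times> real \<Rightarrow> ereal \<Rightarrow> ereal \<Rightarrow>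
   (real \<Rightarrow> real^'m^'m) \<Rightarrow> (real \<Rightarrow> real) \<Rightarrow> bool" where
  "solves_ivp R init a b H h \<longleftrightarrow>
     a < 0 \<and> 0 < b \<and> (H 0, h 0) = init \<and>
     (\<forall>t::real. a < ereal t \<and> ereal t < b \<longrightarrow>
        H t \<in> Sym_plus \<and> 0 < h t \<and>
        ((\<lambda>s. (H s, h s)) has_vector_derivative R (H t, h t)) (at t))"

definition maximal_solution ::
  "((real^'m^'m) \<times> real \<Rightarrow> (real^'m^'m) \<times> real) \<Rightarrow> (real^'m^'m) \<times> real \<Rightarrow> ereal \<Rightarrow> ereal \<Rightarrow>
   (real \<Rightarrow> real^'m^'m) \<Rightarrow> (real \<Rightarrow> real) \<Rightarrow> bool" where
  "maximal_solution R init a b H h \<longleftrightarrow>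
     solves_ivp R init a b H h \<and>
     (\<forall>a' b' H' h'. solves_ivp R init a' b' H' h' \<and> a' \<le> a \<and> b \<le> b' \<and>
        (\<forall>t::real. a < ereal t \<and> ereal t < b \<longrightarrow> H' t = H t \<and> h' t = h t)
        \<longrightarrow> a' = a \<and> b' = b)"

end

theory Submission
  imports Defs "HOL-Computational_Algebra.Fundamental_Theorem_Algebra"
begin

text \<open>
  Write \<open>S = 3 tr (H F H\<inverse> F\<^sup>T) + tr (F\<^sup>2)\<close>. Both flows have the form
  \<open>H' = - (\<alpha> S H + 6 H F H\<inverse> F\<^sup>T H - 6 F\<^sup>T H F) / (64 h)\<close>, \<open>h' = \<beta> S\<close> with positive constants;
  the limits follow from this form together with the fact that \<open>F\<close> is not nilpotent.

  The function \<open>h\<close> grows. Let \<open>A\<close> be the matrix of the endomorphism \<open>F\<close> in a basis that is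
  orthonormal for \<open>H\<close>. Then \<open>S = 3 |A|\<^sup>2 + tr (A\<^sup>2) \<ge> 2 |A|\<^sup>2\<close>. Not being nilpotent, \<open>F\<close> has a nonzero
  complex eigenvalue \<open>\<mu>\<close> (\<open>nonzero_complex_eigenvalue\<close>); it is also an eigenvalue of \<open>A\<close>, so
  \<open>S \<ge> 2 |\<mu>|\<^sup>2\<close> whatever \<open>H\<close> is (\<open>flow_scalar_bounded_below\<close>). Thus \<open>h\<close> grows at least linearly, and
  being positive it cannot have existed forever.

  The function \<open>h\<close> controls \<open>H\<close>. In the orthonormal basis, \<open>H'\<close> is bounded by a multiple of
  \<open>S / h\<close>, that is of \<open>h' / h\<close>. Hence \<open>H\<close> is pinched between multiples of powers of \<open>h\<close>
  (\<open>ln_quadratic_form_variation\<close>), and as long as \<open>h\<close> is bounded away from zero and infinity, the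
  solution stays in a compact part of its domain and can be continued at a finite endpoint
  (\<open>solution_continues_right\<close>, \<open>solution_continues_left\<close>, which rest on the Picard-Lindeloef theorem).
  So \<open>h\<close> tends to zero at the beginning of a maximal solution and to infinity at its end.

  The determinant follows \<open>h\<close>. The traces of \<open>F H\<inverse> F\<^sup>T H\<close> and \<open>H\<inverse> F\<^sup>T H F\<close> agree, so by the
  Jacobi formula \<open>det H\<close> times a fixed positive power of \<open>h\<close> is constant (\<open>det_conserved\<close>). The limits
  of \<open>det H\<close> are therefore the reciprocals of those of \<open>h\<close>.
\<close>

section \<open>Continuation of solutions of autonomous equations\<close>

text \<open>Composing \<open>f\<close> with the projection onto the ball makes it bounded and Lipschitz on the
  whole space and does not change it on the ball. The fixed point theorem of Banach then gives a
  solution of the integral equation on a short interval. Existence to the right of the initial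
  time is what the continuation of solutions past an endpoint needs.\<close>

lemma picard_lindelof_right:
  fixes f :: "'a::euclidean_space \<Rightarrow> 'a"
  assumes lip: "L-lipschitz_on (cball x0 r) f" and r: "r > 0"
  shows "\<exists>\<delta>>0. \<exists>x. x 0 = x0 \<and>
    (\<forall>t\<in>{0..\<delta>}. x t \<in> cball x0 r \<and> (x has_vector_derivative f (x t)) (at t within {0..\<delta>}))"
proof -
  define P where "P = closest_point (cball x0 r)"
  define g where "g = (\<lambda>z. f (P z))"
  have L: "L \<ge> 0" using lip by (rule lipschitz_on_nonneg)
  have P_in: "P z \<in> cball x0 r" for z
    unfolding P_def using r by (intro closest_point_in_set) auto
  have P_id: "P z = z" if "z \<in> cball x0 r" for z
    unfolding P_def using that by (rule closest_point_self)
  have g_lip: "norm (g y - g z) \<le> L * dist y z" for y z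
  proof -
    have "norm (g y - g z) \<le> L * dist (P y) (P z)"
      unfolding g_def using lipschitz_onD[OF lip P_in P_in] by (simp add: dist_norm)
    also have "\<dots> \<le> L * dist y z"
      unfolding P_def using L r by (intro mult_left_mono closest_point_lipschitz) auto
    finally show ?thesis .
  qed
  have g_cont: "continuous_on S g" for S
    by (rule lipschitz_on_continuous_on[where L = L], rule lipschitz_onI)
       (use g_lip L in \<open>auto simp: dist_norm\<close>)
  define M where "M = norm (f x0) + L * r + 1"
  have M: "M > 0" using L r by (auto simp: M_def intro!: add_nonneg_pos)
  have g_bound: "norm (g z) \<le> M" for z
  proof -
    have "norm (f (P z) - f x0) \<le> L * dist (P z) x0"
      using lipschitz_onD[OF lip P_in[of z], of x0] r by (simp add: dist_norm)
    also have "\<dots> \<le> L * r"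
      using P_in[of z] L by (intro mult_left_mono) (auto simp: dist_commute)
    finally show ?thesis
      unfolding g_def M_def using norm_triangle_ineq2[of "f (P z)" "f x0"] by linarith
  qed
  \<comment> \<open>The first bound keeps the solution in the ball, the second makes the operator a contraction.\<close>
  define \<delta> where "\<delta> = min (r / M) (1 / (2 * (L + 1)))"
  have \<delta>: "\<delta> > 0" using r M L by (auto simp: \<delta>_def)
  have M\<delta>: "M * \<delta> \<le> r"
    using M by (simp add: \<delta>_def min_def field_simps)
  have L\<delta>: "L * \<delta> \<le> 1 / 2"
  proof -
    have "L * \<delta> \<le> L * (1 / (2 * (L + 1)))"
      using L by (intro mult_left_mono) (auto simp: \<delta>_def)
    also have "\<dots> \<le> 1 / 2" using L by (simp add: field_simps)
    finally show ?thesis .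
  qed
  \<comment> \<open>The Picard operator acts on functions on the whole line, which it makes constant outside
    \<open>{0..\<delta>}\<close>: so it maps a complete metric type into itself.\<close>
  define cl where "cl = (\<lambda>t::real. max 0 (min t \<delta>))"
  have cl_in: "cl t \<in> {0..\<delta>}" for t using \<delta> by (auto simp: cl_def)
  have cl_id: "cl t = t" if "t \<in> {0..\<delta>}" for t using that by (auto simp: cl_def)
  define J where "J = (\<lambda>x :: real \<Rightarrow>\<^sub>C 'a. \<lambda>t. x0 + integral {0..cl t} (\<lambda>s. g (x s)))"
  have gx_cont: "continuous_on S (\<lambda>s. g (apply_bcontfun x s))" for x S
    by (rule continuous_on_compose2[OF g_cont[of UNIV]]) auto
  have J_bound: "norm (J x t - x0) \<le> M * \<delta>" for x t
  proof -
    have "norm (integral {0..cl t} (\<lambda>s. g (x s))) \<le> M * (cl t - 0)"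
      by (rule integral_bound[OF _ gx_cont g_bound]) (use cl_in[of t] in simp)
    then have "norm (J x t - x0) \<le> M * (cl t - 0)"
      by (simp add: J_def)
    also have "\<dots> \<le> M * \<delta>" using cl_in[of t] M by (intro mult_left_mono) auto
    finally show ?thesis .
  qed
  have J_cont: "continuous_on UNIV (J x)" for x
  proof -
    have 1: "continuous_on {0..\<delta>} (\<lambda>t. x0 + integral {0..t} (\<lambda>s. g (x s)))"
      by (intro continuous_intros indefinite_integral_continuous_1 integrable_continuous_real gx_cont)
    have 2: "continuous_on UNIV cl" unfolding cl_def by (intro continuous_intros)
    show ?thesis unfolding J_def
      by (rule continuous_on_compose2[OF 1 2]) (use cl_in in auto)
  qed
  have J_bc: "J x \<in> bcontfun" for x
  proof (rule bcontfun_normI[OF J_cont])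
    show "norm (J x t) \<le> norm x0 + M * \<delta>" for t
      using J_bound[of x t] norm_triangle_ineq2[of "J x t" x0] by linarith
  qed
  define \<Phi> where "\<Phi> = (\<lambda>x. Bcontfun (J x))"
  have \<Phi>: "apply_bcontfun (\<Phi> x) = J x" for x
    unfolding \<Phi>_def using J_bc by (rule Bcontfun_inverse)
  have "\<exists>!x. \<Phi> x = x"
  proof (rule banach_fix_type[of "1/2"])
    show "\<forall>x y. dist (\<Phi> x) (\<Phi> y) \<le> 1 / 2 * dist x y"
    proof (intro allI dist_bound)
      fix x y t
      have "dist (\<Phi> x t) (\<Phi> y t) = norm (integral {0..cl t} (\<lambda>s. g (x s) - g (y s)))"
        by (simp add: \<Phi> J_def dist_norm integral_diff integrable_continuous_real gx_cont)
      also have "\<dots> \<le> (L * dist x y) * (cl t - 0)"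
      proof (rule integral_bound)
        show "norm (g (x s) - g (y s)) \<le> L * dist x y" for s
          using g_lip[of "x s" "y s"] mult_left_mono[OF dist_bounded[of x s y] L] by linarith
      qed (use cl_in[of t] in \<open>auto intro!: continuous_intros gx_cont\<close>)
      also have "\<dots> \<le> (L * dist x y) * \<delta>"
        using cl_in[of t] L by (intro mult_left_mono) auto
      also have "\<dots> = (L * \<delta>) * dist x y" by simp
      also have "\<dots> \<le> 1 / 2 * dist x y"
        using L\<delta> by (intro mult_right_mono) auto
      finally show "dist (\<Phi> x t) (\<Phi> y t) \<le> 1 / 2 * dist x y" .
    qed
  qed auto
  then obtain x where x: "\<Phi> x = x" by blast
  have xJ: "apply_bcontfun x t = J x t" for t
    using \<Phi>[of x] x by simp
  have x_ball: "x t \<in> cball x0 r" for t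
    using J_bound[of x t] M\<delta> by (simp add: xJ dist_norm norm_minus_commute)
  have "(x has_vector_derivative f (x t)) (at t within {0..\<delta>})" if t: "t \<in> {0..\<delta>}" for t
  proof -
    have "((\<lambda>u. x0 + integral {0..u} (\<lambda>s. g (x s))) has_vector_derivative (0 + g (x t)))
        (at t within {0..\<delta>})"
      by (intro has_vector_derivative_add has_vector_derivative_const
          integral_has_vector_derivative gx_cont t)
    moreover have "g (x t) = f (x t)" unfolding g_def using P_id[OF x_ball] by simp
    moreover have "x u = x0 + integral {0..u} (\<lambda>s. g (x s))" if "u \<in> {0..\<delta>}" for u
      using xJ[of u] cl_id[OF that] unfolding J_def by metis
    ultimately show ?thesis
      unfolding add_0_left
      using has_vector_derivative_transform[OF t, of x "\<lambda>u. x0 + integral {0..u} (\<lambda>s. g (x s))"] by metis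
  qed
  moreover have "x 0 = x0" using xJ[of 0] cl_id[of 0] \<delta> by (simp add: J_def)
  ultimately show ?thesis using \<delta> x_ball by blast
qed

text \<open>A solution that converges at its endpoint \<open>b\<close> can be glued to a solution starting at the limit.\<close>

lemma solution_extends_right:
  fixes f :: "'a::euclidean_space \<Rightarrow> 'a" and x :: "real \<Rightarrow> 'a" and c :: ereal and b :: real
  assumes cb: "c < b"
    and x: "\<And>t. c < ereal t \<Longrightarrow> t < b \<Longrightarrow> x t \<in> D \<and> (x has_vector_derivative f (x t)) (at t)"
    and lim: "(x \<longlongrightarrow> x1) (at_left b)"
    and cont: "continuous_on D f"
    and y: "\<delta> > 0" "y 0 = x1"
      "\<And>t. t \<in> {0..\<delta>} \<Longrightarrow> y t \<in> D \<and> (y has_vector_derivative f (y t)) (at t within {0..\<delta>})"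
  shows "\<exists>z. (\<forall>t<b. z t = x t) \<and>
    (\<forall>t. c < ereal t \<and> t < b + \<delta> \<longrightarrow> z t \<in> D \<and> (z has_vector_derivative f (z t)) (at t))"
proof -
  define z where "z = (\<lambda>t. if t < b then x t else y (t - b))"
  have zD: "z t \<in> D" if "c < ereal t" "t \<le> b + \<delta>" for t
    using x[of t] y(3)[of "t - b"] that by (auto simp: z_def)
  have left: "(z has_vector_derivative f (z t)) (at t)" if "c < ereal t" "t < b" for t
  proof (rule has_vector_derivative_transform_within_open[of x _ _ "{..<b}"])
    show "(x has_vector_derivative f (z t)) (at t)" using x[of t] that by (simp add: z_def)
  qed (use that in \<open>auto simp: z_def\<close>)
  have shift: "((\<lambda>s. y (s - b)) has_vector_derivative f (y (t - b))) (at t within {b..b+\<delta>})"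
    if "b \<le> t" "t \<le> b + \<delta>" for t
  proof -
    have "(y \<circ> (\<lambda>s. s - b) has_vector_derivative (1 *\<^sub>R f (y (t - b)))) (at t within {b..b+\<delta>})"
    proof (rule vector_diff_chain_within)
      show "((\<lambda>s. s - b) has_vector_derivative 1) (at t within {b..b + \<delta>})"
        by (auto intro!: derivative_eq_intros)
      have "(\<lambda>s. s - b) ` {b..b + \<delta>} = {0..\<delta>}"
        by (force simp: image_iff intro!: bexI[of _ "_ + b"])
      then show "(y has_vector_derivative f (y (t - b))) (at (t - b) within (\<lambda>s. s - b) ` {b..b + \<delta>})"
        using y(3)[of "t - b"] that by (simp only: atLeastAtMost_iff) auto
    qed
    then show ?thesis by (simp add: o_def)
  qed
  have right: "(z has_vector_derivative f (z t)) (at t)" if "b < t" "t < b + \<delta>" for t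
  proof (rule has_vector_derivative_transform_within_open[of "\<lambda>s. y (s - b)" _ _ "{b<..<b+\<delta>}"])
    have "((\<lambda>s. y (s - b)) has_vector_derivative f (y (t - b))) (at t within {b<..<b+\<delta>})"
      using shift[of t] that by (auto intro: has_vector_derivative_within_subset)
    then show "((\<lambda>s. y (s - b)) has_vector_derivative f (z t)) (at t)"
      using that by (simp add: z_def has_vector_derivative_def at_within_open[of t "{b<..<b+\<delta>}"])
  qed (use that in \<open>auto simp: z_def\<close>)
  have zb: "isCont z b"
  proof -
    have l: "(z \<longlongrightarrow> x1) (at_left b)"
      by (rule Lim_transform_eventually[OF lim])
         (auto simp: z_def eventually_at_filter)
    have "continuous (at b within {b..b+\<delta>}) (\<lambda>s. y (s - b))"
      using shift[of b] y(1) by (auto intro: has_vector_derivative_continuous)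
    then have "((\<lambda>s. y (s - b)) \<longlongrightarrow> x1) (at b within {b..b+\<delta>})"
      using y(2) by (simp add: continuous_within)
    then have "((\<lambda>s. y (s - b)) \<longlongrightarrow> x1) (at_right b)"
      using y(1) by (simp add: at_within_Icc_at_right)
    then have r: "(z \<longlongrightarrow> x1) (at_right b)"
      by (rule Lim_transform_eventually) (auto simp: z_def eventually_at_filter)
    have "z b = x1" using y(2) by (simp add: z_def)
    with l r show ?thesis by (simp add: isCont_def filterlim_split_at)
  qed
  have zC: "isCont z t" if "c < ereal t" "t < b + \<delta>" for t
  proof -
    consider "t < b" | "t = b" | "t > b" by linarith
    then show ?thesis
    proof cases
      case 1 then show ?thesis by (intro has_vector_derivative_continuous[OF left[OF that(1)]])
    next
      case 2 then show ?thesis using zb by simp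
    next
      case 3 then show ?thesis by (intro has_vector_derivative_continuous[OF right[OF _ that(2)]])
    qed
  qed
  \<comment> \<open>At the junction the equation follows from its integrated form, which does not see
    the single exceptional point.\<close>
  have mid: "(z has_vector_derivative f (z b)) (at b)"
  proof -
    obtain p where p: "c < ereal p" "p < b" using ereal_dense2[OF cb] by auto
    define q where "q = b + \<delta> / 2"
    have q: "b < q" "q < b + \<delta>" using y(1) by (auto simp: q_def)
    note pq = p q
    have cp: "c < ereal t" if "p \<le> t" for t
      using p(1) that by (meson ereal_less_eq(3) less_le_trans)
    have zc: "continuous_on {p..q} z"
      using pq cp by (intro continuous_at_imp_continuous_on ballI zC) auto
    have fzc: "continuous_on {p..q} (\<lambda>t. f (z t))"
      by (rule continuous_on_compose2[OF cont zc]) (use pq cp zD in auto)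
    have int: "z t = z p + integral {p..t} (\<lambda>s. f (z s))" if "t \<in> {p..q}" for t
    proof -
      have "((\<lambda>s. f (z s)) has_integral (z t - z p)) {p..t}"
      proof (rule fundamental_theorem_of_calculus_interior_strong[of "{b}"])
        show "(z has_vector_derivative f (z s)) (at s)" if "s \<in> {p<..<t} - {b}" for s
          using that \<open>t \<in> {p..q}\<close> pq cp[of s] left[of s] right[of s] by (cases "s < b") auto
      qed (use that zc in \<open>auto intro: continuous_on_subset\<close>)
      then show ?thesis by (simp add: integral_unique)
    qed
    have "((\<lambda>u. z p + integral {p..u} (\<lambda>s. f (z s))) has_vector_derivative (0 + f (z b))) (at b within {p..q})"
      by (intro has_vector_derivative_add has_vector_derivative_const
          integral_has_vector_derivative fzc) (use pq in auto)
    then have "(z has_vector_derivative f (z b)) (at b within {p..q})"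
      unfolding add_0_left
      by (rule has_vector_derivative_transform[rotated 2]) (use pq in simp, rule int)
    then have "(z has_vector_derivative f (z b)) (at b within {p<..<q})"
      by (rule has_vector_derivative_within_subset) auto
    then show ?thesis
      using pq by (simp add: has_vector_derivative_def at_within_open[of b "{p<..<q}"])
  qed
  have "(z has_vector_derivative f (z t)) (at t)" if "c < ereal t" "t < b + \<delta>" for t
  proof (cases t b rule: linorder_cases)
    case less then show ?thesis using left[OF that(1)] by blast
  next
    case equal then show ?thesis using mid by blast
  next
    case greater then show ?thesis using right[OF _ that(2)] by blast
  qed
  moreover have "\<forall>t<b. z t = x t" by (simp add: z_def)
  ultimately show ?thesis using zD by (intro exI[of _ z]) (simp add: less_imp_le)
qed

text \<open>Bounded speed makes the curve Lipschitz, so it extends continuously to the closed interval.\<close>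

lemma bounded_speed_limit_at_left:
  fixes x :: "real \<Rightarrow> 'a::euclidean_space"
  assumes "c < b"
    and der: "\<And>t. c < t \<Longrightarrow> t < b \<Longrightarrow> (x has_vector_derivative x' t) (at t)"
    and bound: "\<And>t. c < t \<Longrightarrow> t < b \<Longrightarrow> norm (x' t) \<le> M"
  shows "\<exists>x1. (x \<longlongrightarrow> x1) (at_left b)"
proof -
  have M: "0 \<le> M" using order_trans[OF norm_ge_zero bound[of "(c+b)/2"]] \<open>c < b\<close> by simp
  have lip: "M-lipschitz_on {c<..<b} x"
  proof (rule lipschitz_onI[OF _ M])
    fix s t assume st: "s \<in> {c<..<b}" "t \<in> {c<..<b}"
    have "norm (x s - x t) \<le> M * norm (s - t)"
    proof (rule differentiable_bound[where f' = "\<lambda>u h. h *\<^sub>R x' u"])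
      show "(x has_derivative (\<lambda>h. h *\<^sub>R x' u)) (at u within {c<..<b})" if "u \<in> {c<..<b}" for u
        using der[of u] that by (auto simp: has_vector_derivative_def intro: has_derivative_at_withinI)
      show "onorm (\<lambda>h. h *\<^sub>R x' u) \<le> M" if "u \<in> {c<..<b}" for u
      proof (rule onorm_le)
        show "norm (h *\<^sub>R x' u) \<le> M * norm h" for h
          using mult_right_mono[OF bound[of u], of "norm h"] that by (simp add: mult.commute)
      qed
    qed (use st in auto)
    then show "dist (x s) (x t) \<le> M * dist s t" by (simp add: dist_norm)
  qed
  then obtain g where g: "M-lipschitz_on (closure {c<..<b}) g" "\<And>t. t \<in> {c<..<b} \<Longrightarrow> g t = x t"
    using lipschitz_extend_closure by blast
  have "continuous_on {c..b} g" using g(1) \<open>c < b\<close> by (simp add: lipschitz_on_continuous_on)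
  then have "(g \<longlongrightarrow> g b) (at b within {c..b})" using \<open>c < b\<close> by (simp add: continuous_on_def)
  then have "(g \<longlongrightarrow> g b) (at_left b)" using \<open>c < b\<close> by (simp add: at_within_Icc_at_left)
  moreover have "eventually (\<lambda>t. t \<in> {c<..<b}) (at_left b)"
    using \<open>c < b\<close> by (auto simp: eventually_at_left intro!: exI[of _ c])
  then have "eventually (\<lambda>t. g t = x t) (at_left b)"
    by (rule eventually_mono) (rule g(2))
  ultimately have "(x \<longlongrightarrow> g b) (at_left b)" by (rule Lim_transform_eventually)
  then show ?thesis ..
qed

text \<open>On the compact set \<open>K\<close> the field is bounded, so the solution has bounded speed near \<open>b\<close> and
  converges to a point of \<open>K\<close>, from which it can be continued. The part of the
  solution before time \<open>d\<close> is carried along, so that the continuation solves the equation on the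
  whole extended interval.\<close>

lemma solution_continues_right:
  fixes f :: "'a::euclidean_space \<Rightarrow> 'a" and x :: "real \<Rightarrow> 'a" and c :: ereal and b d :: real
  assumes cd: "c < ereal d" "d < b"
    and x: "\<And>t. c < ereal t \<Longrightarrow> t < b \<Longrightarrow> x t \<in> D \<and> (x has_vector_derivative f (x t)) (at t)"
    and K: "compact K" "K \<subseteq> D" "\<And>t. d < t \<Longrightarrow> t < b \<Longrightarrow> x t \<in> K"
    and cont: "continuous_on D f"
    and local: "\<And>x1. x1 \<in> D \<Longrightarrow> \<exists>\<delta>>0. \<exists>y. y 0 = x1 \<and>
      (\<forall>t\<in>{0..\<delta>}. y t \<in> D \<and> (y has_vector_derivative f (y t)) (at t within {0..\<delta>}))"
  shows "\<exists>\<delta>>0. \<exists>z. (\<forall>t<b. z t = x t) \<and>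
    (\<forall>t. c < ereal t \<and> t < b + \<delta> \<longrightarrow> z t \<in> D \<and> (z has_vector_derivative f (z t)) (at t))"
proof -
  have cdt: "c < ereal t" if "d \<le> t" for t
    using cd(1) that by (meson ereal_less_eq(3) less_le_trans)
  have "compact (f ` K)"
    by (rule compact_continuous_image[OF continuous_on_subset[OF cont K(2)] K(1)])
  then obtain M where M: "\<And>z. z \<in> K \<Longrightarrow> norm (f z) \<le> M"
    using compact_imp_bounded bounded_iff by (metis imageI)
  have "\<exists>x1. (x \<longlongrightarrow> x1) (at_left b)"
    by (rule bounded_speed_limit_at_left[OF cd(2), of x "\<lambda>t. f (x t)" M])
       (use x cdt K(3) M in \<open>auto simp: less_imp_le\<close>)
  then obtain x1 where lim: "(x \<longlongrightarrow> x1) (at_left b)" ..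
  have ev: "eventually (\<lambda>t. x t \<in> K) (at_left b)"
    unfolding eventually_at_left[OF cd(2)] using cd(2) K(3) by blast
  have "x1 \<in> K"
    using Lim_in_closed_set[OF compact_imp_closed[OF K(1)] ev _ lim] by (simp add: trivial_limit_at_left_real)
  then have "x1 \<in> D" using K(2) by blast
  then obtain \<delta> y where y: "\<delta> > 0" "y 0 = x1"
      "\<forall>t\<in>{0..\<delta>}. y t \<in> D \<and> (y has_vector_derivative f (y t)) (at t within {0..\<delta>})"
    using local by blast
  have "c < ereal b" using cdt[of b] cd(2) by simp
  then have "\<exists>z. (\<forall>t<b. z t = x t) \<and>
      (\<forall>t. c < ereal t \<and> t < b + \<delta> \<longrightarrow> z t \<in> D \<and> (z has_vector_derivative f (z t)) (at t))"
    using y x by (intro solution_extends_right[where y = y and x = x, OF _ _ lim cont]) auto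
  with y(1) show ?thesis by blast
qed

text \<open>This is the previous lemma after reversing time, which turns \<open>f\<close> into \<open>- f\<close>; hence the sign in
  the hypothesis on local solutions.\<close>

lemma solution_continues_left:
  fixes f :: "'a::euclidean_space \<Rightarrow> 'a" and x :: "real \<Rightarrow> 'a" and c :: ereal and b d :: real
  assumes cd: "ereal d < c" "b < d"
    and x: "\<And>t. b < t \<Longrightarrow> ereal t < c \<Longrightarrow> x t \<in> D \<and> (x has_vector_derivative f (x t)) (at t)"
    and K: "compact K" "K \<subseteq> D" "\<And>t. b < t \<Longrightarrow> t < d \<Longrightarrow> x t \<in> K"
    and cont: "continuous_on D f"
    and local: "\<And>x1. x1 \<in> D \<Longrightarrow> \<exists>\<delta>>0. \<exists>y. y 0 = x1 \<and>
      (\<forall>t\<in>{0..\<delta>}. y t \<in> D \<and> (y has_vector_derivative - f (y t)) (at t within {0..\<delta>}))"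
  shows "\<exists>\<delta>>0. \<exists>z. (\<forall>t>b. z t = x t) \<and>
    (\<forall>t. b - \<delta> < t \<and> ereal t < c \<longrightarrow> z t \<in> D \<and> (z has_vector_derivative f (z t)) (at t))"
proof -
  have reflect: "((\<lambda>s. w (- s)) has_vector_derivative - w') (at t)"
    if "(w has_vector_derivative w') (at (- t))" for w :: "real \<Rightarrow> 'a" and w' t
  proof -
    have "((\<lambda>s. - s) has_vector_derivative (- 1)) (at t)" by (auto intro!: derivative_eq_intros)
    from vector_diff_chain_at[OF this that] show ?thesis by (simp add: o_def)
  qed
  have neg: "- c < ereal t \<longleftrightarrow> ereal (- t) < c" for t by (cases c) auto
  have "\<exists>\<delta>>0. \<exists>z. (\<forall>t< - b. z t = x (- t)) \<and>
    (\<forall>t. - c < ereal t \<and> t < - b + \<delta> \<longrightarrow> z t \<in> D \<and> (z has_vector_derivative - f (z t)) (at t))"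
  proof (rule solution_continues_right[where d = "- d"])
    show "- c < ereal (- d)" using cd(1) neg[of "- d"] by simp
    show "x (- t) \<in> D \<and> ((\<lambda>t. x (- t)) has_vector_derivative - f (x (- t))) (at t)"
      if "- c < ereal t" "t < - b" for t
      using x[of "- t"] that neg by (auto intro!: reflect)
    show "continuous_on D (\<lambda>y. - f y)" by (intro continuous_intros cont)
  qed (use cd K local in auto)
  then obtain \<delta> z where z: "\<delta> > 0" "\<forall>t< - b. z t = x (- t)"
    "\<forall>t. - c < ereal t \<and> t < - b + \<delta> \<longrightarrow> z t \<in> D \<and> (z has_vector_derivative - f (z t)) (at t)"
    by blast
  have "z (- t) \<in> D \<and> ((\<lambda>s. z (- s)) has_vector_derivative f (z (- t))) (at t)"
    if "b - \<delta> < t" "ereal t < c" for t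
    using reflect[of z "- f (z (- t))" t] z(3)[rule_format, of "- t"] neg[of "- t"] that by simp
  moreover have "\<forall>t>b. z (- t) = x t" using z(2) by simp
  ultimately show ?thesis using z(1) by (intro exI[of _ \<delta>] conjI exI[of _ "\<lambda>t. z (- t)"]) auto
qed

section \<open>Lipschitz estimates near a point\<close>

text \<open>The property is attached to a single point, so that it passes through maps such as matrix
  inversion that are Lipschitz only near some points.\<close>

definition lipschitz_near :: "('a::metric_space \<Rightarrow> 'b::metric_space) \<Rightarrow> 'a \<Rightarrow> bool" where
  "lipschitz_near f x \<longleftrightarrow> (\<exists>r>0. \<exists>L. L-lipschitz_on (cball x r) f)"

lemma lipschitz_nearE:
  assumes "lipschitz_near f x"
  obtains r L where "r > 0" "L-lipschitz_on (cball x r) f"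
  using assms unfolding lipschitz_near_def by blast

lemma lipschitz_near_imp_isCont:
  assumes "lipschitz_near f x"
  shows "isCont f x"
proof -
  obtain r L where r: "r > 0" and L: "L-lipschitz_on (cball x r) f"
    using assms by (rule lipschitz_nearE)
  have "continuous_on (ball x r) f"
    using lipschitz_on_continuous_on[OF L] by (rule continuous_on_subset) auto
  then show ?thesis using r by (simp add: continuous_on_eq_continuous_at)
qed

lemma lipschitz_near_compose:
  assumes f: "lipschitz_near f x" and g: "lipschitz_near g (f x)"
  shows "lipschitz_near (\<lambda>y. g (f y)) x"
proof -
  obtain r L where r: "r > 0" and L: "L-lipschitz_on (cball x r) f"
    using f by (rule lipschitz_nearE)
  obtain s M where s: "s > 0" and M: "M-lipschitz_on (cball (f x) s) g"
    using g by (rule lipschitz_nearE)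
  have L0: "L \<ge> 0" using L by (rule lipschitz_on_nonneg)
  define q where "q = min r (s / (L + 1))"
  have q: "q > 0" using r s L0 by (simp add: q_def)
  have Lq: "L-lipschitz_on (cball x q) f"
    using L by (rule lipschitz_on_subset) (auto simp: q_def)
  have "f ` cball x q \<subseteq> cball (f x) s"
  proof (rule image_subsetI)
    fix y assume y: "y \<in> cball x q"
    have "dist (f x) (f y) \<le> L * dist x y"
      using lipschitz_onD[OF Lq _ y, of x] q by simp
    also have "\<dots> \<le> L * (s / (L + 1))"
      using y L0 by (intro mult_left_mono) (auto simp: q_def)
    also have "\<dots> \<le> s" using L0 s by (simp add: field_simps)
    finally show "f y \<in> cball (f x) s" by simp
  qed
  then have "(M * L)-lipschitz_on (cball x q) (\<lambda>y. g (f y))"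
    by (intro lipschitz_on_compose2[OF Lq] lipschitz_on_subset[OF M])
  with q show ?thesis unfolding lipschitz_near_def by blast
qed

lemma lipschitz_near_const: "lipschitz_near (\<lambda>y. c) x"
  unfolding lipschitz_near_def by (intro exI[of _ 1] conjI exI[of _ 0] lipschitz_on_constant) auto

lemma lipschitz_near_bounded_linear:
  assumes "bounded_linear f"
  shows "lipschitz_near f x"
proof -
  interpret bounded_linear f by fact
  obtain B where "B-lipschitz_on (cball x 1) f" by (rule lipschitz_boundE)
  then show ?thesis unfolding lipschitz_near_def by (intro exI[of _ 1]) auto
qed

lemma lipschitz_near_Pair:
  assumes "lipschitz_near f x" "lipschitz_near g x"
  shows "lipschitz_near (\<lambda>y. (f y, g y)) x"
proof -
  obtain r L where r: "r > 0" and L: "L-lipschitz_on (cball x r) f"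
    using assms(1) by (rule lipschitz_nearE)
  obtain s M where s: "s > 0" and M: "M-lipschitz_on (cball x s) g"
    using assms(2) by (rule lipschitz_nearE)
  have "(sqrt (L\<^sup>2 + M\<^sup>2))-lipschitz_on (cball x (min r s)) (\<lambda>y. (f y, g y))"
    by (intro lipschitz_on_Pair lipschitz_on_subset[OF L] lipschitz_on_subset[OF M]) auto
  then show ?thesis unfolding lipschitz_near_def
    using r s by (intro exI[of _ "min r s"]) auto
qed

lemma lipschitz_near_add:
  fixes f g :: "'a::metric_space \<Rightarrow> 'b::real_normed_vector"
  assumes "lipschitz_near f x" "lipschitz_near g x"
  shows "lipschitz_near (\<lambda>y. f y + g y) x"
  using lipschitz_near_compose[OF lipschitz_near_Pair[OF assms],
      of "\<lambda>z. fst z + snd z"]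
  by (simp add: lipschitz_near_bounded_linear bounded_linear_add bounded_linear_fst bounded_linear_snd)

lemma lipschitz_near_uminus:
  fixes f :: "'a::metric_space \<Rightarrow> 'b::real_normed_vector"
  assumes "lipschitz_near f x"
  shows "lipschitz_near (\<lambda>y. - f y) x"
  using lipschitz_near_compose[OF assms, of uminus]
  by (simp add: lipschitz_near_bounded_linear bounded_linear_minus[OF bounded_linear_ident])

lemma lipschitz_near_diff:
  fixes f g :: "'a::metric_space \<Rightarrow> 'b::real_normed_vector"
  assumes "lipschitz_near f x" "lipschitz_near g x"
  shows "lipschitz_near (\<lambda>y. f y - g y) x"
  using lipschitz_near_add[OF assms(1) lipschitz_near_uminus[OF assms(2)]] by simp

lemma lipschitz_near_bilinear:
  assumes bi: "bounded_bilinear bi"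
    and "lipschitz_near f x" "lipschitz_near g x"
  shows "lipschitz_near (\<lambda>y. bi (f y) (g y)) x"
proof -
  interpret bounded_bilinear bi by (rule bi)
  obtain r L where r: "r > 0" and L: "L-lipschitz_on (cball x r) f"
    using assms(2) by (rule lipschitz_nearE)
  obtain s M where s: "s > 0" and M: "M-lipschitz_on (cball x s) g"
    using assms(3) by (rule lipschitz_nearE)
  obtain K where K: "K > 0" "\<And>a b. norm (bi a b) \<le> norm a * norm b * K"
    using pos_bounded by blast
  define q where "q = min r s"
  have q: "q > 0" using r s by (simp add: q_def)
  have Lq: "L-lipschitz_on (cball x q) f" and Mq: "M-lipschitz_on (cball x q) g"
    using L M by (auto simp: q_def intro: lipschitz_on_subset)
  have L0: "L \<ge> 0" and M0: "M \<ge> 0" using L M by (auto dest: lipschitz_on_nonneg)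
  have fb: "norm (f y) \<le> norm (f x) + L * q" if "y \<in> cball x q" for y
  proof -
    have "dist (f y) (f x) \<le> L * dist y x" using that q by (intro lipschitz_onD[OF Lq]) auto
    also have "\<dots> \<le> L * q" using that L0 by (intro mult_left_mono) (auto simp: dist_commute)
    finally show ?thesis using norm_triangle_ineq2[of "f y" "f x"] by (simp add: dist_norm)
  qed
  have gb: "norm (g y) \<le> norm (g x) + M * q" if "y \<in> cball x q" for y
  proof -
    have "dist (g y) (g x) \<le> M * dist y x" using that q by (intro lipschitz_onD[OF Mq]) auto
    also have "\<dots> \<le> M * q" using that M0 by (intro mult_left_mono) (auto simp: dist_commute)
    finally show ?thesis using norm_triangle_ineq2[of "g y" "g x"] by (simp add: dist_norm)
  qed
  define C where "C = L * (norm (g x) + M * q) * K + (norm (f x) + L * q) * M * K"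
  have C: "C \<ge> 0" unfolding C_def using L0 M0 q K by (intro add_nonneg_nonneg mult_nonneg_nonneg) auto
  have "C-lipschitz_on (cball x q) (\<lambda>y. bi (f y) (g y))"
  proof (rule lipschitz_onI[OF _ C])
    fix y z assume y: "y \<in> cball x q" and z: "z \<in> cball x q"
    have "norm (bi (f y) (g y) - bi (f z) (g z)) = norm (bi (f y - f z) (g y) + bi (f z) (g y - g z))"
      by (simp add: diff_left diff_right)
    also have "\<dots> \<le> norm (f y - f z) * norm (g y) * K + norm (f z) * norm (g y - g z) * K"
      using norm_triangle_ineq K(2) add_mono order_trans by meson
    also have "\<dots> \<le> (L * dist y z) * (norm (g x) + M * q) * K
        + (norm (f x) + L * q) * (M * dist y z) * K"
      using lipschitz_onD[OF Lq y z] lipschitz_onD[OF Mq y z] fb[OF z] gb[OF y] K(1) L0 M0 q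
      by (intro add_mono mult_mono mult_right_mono) (auto simp: dist_norm)
    also have "\<dots> = C * dist y z" by (simp add: C_def algebra_simps)
    finally show "dist (bi (f y) (g y)) (bi (f z) (g z)) \<le> C * dist y z" by (simp add: dist_norm)
  qed
  with q show ?thesis unfolding lipschitz_near_def by blast
qed

lemma lipschitz_near_inverse:
  fixes a :: real
  assumes "a > 0"
  shows "lipschitz_near (\<lambda>h. 1 / h) a"
proof -
  have "(4 / a\<^sup>2)-lipschitz_on (cball a (a / 2)) (\<lambda>h. 1 / h)"
  proof (rule lipschitz_onI)
    fix s t assume "s \<in> cball a (a / 2)" "t \<in> cball a (a / 2)"
    then have s: "s \<ge> a / 2" and t: "t \<ge> a / 2" by (auto simp: dist_real_def abs_if split: if_splits)
    then have pos: "s > 0" "t > 0" using assms by linarith+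
    have "(a / 2) * (a / 2) \<le> s * t" using s t assms pos by (intro mult_mono) auto
    then have "1 / (s * t) \<le> 1 / ((a / 2) * (a / 2))"
      using assms by (intro divide_left_mono) (auto simp: pos)
    then have "\<bar>s - t\<bar> * (1 / (s * t)) \<le> \<bar>s - t\<bar> * (4 / a\<^sup>2)"
      by (intro mult_left_mono) (auto simp: power2_eq_square)
    moreover have "\<bar>1 / s - 1 / t\<bar> = \<bar>s - t\<bar> * (1 / (s * t))"
    proof -
      have "1 / s - 1 / t = (t - s) * (1 / (s * t))" using pos by (simp add: field_simps)
      then show ?thesis using pos by (simp add: abs_mult abs_minus_commute)
    qed
    ultimately show "dist (1 / s) (1 / t) \<le> 4 / a\<^sup>2 * dist s t"
      by (simp add: dist_real_def mult.commute)
  qed simp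
  then show ?thesis unfolding lipschitz_near_def using assms by (intro exI[of _ "a / 2"]) auto
qed

lemma bounded_bilinear_matrix_mult:
  "bounded_bilinear ((**) :: real^'n^'m \<Rightarrow> real^'k^'n \<Rightarrow> real^'k^'m)"
  unfolding bilinear_conv_bounded_bilinear[symmetric] bilinear_def
  by (auto intro!: linearI simp: vec_eq_iff matrix_matrix_mult_def sum.distrib sum_distrib_left algebra_simps)

lemma isCont_det: "isCont (det :: real^'m^'m \<Rightarrow> real) A"
  unfolding det_def by (intro continuous_intros)

lemma matrix_inv_mult:
  fixes A :: "real^'m^'m"
  assumes "invertible A"
  shows "A ** matrix_inv A = mat 1" "matrix_inv A ** A = mat 1"
  using assms unfolding matrix_inv_def invertible_def by (metis (mono_tags, lifting) someI_ex)+

text \<open>Since \<open>X\<inverse> - Y\<inverse> = X\<inverse> (Y - X) Y\<inverse>\<close>, it is enough to bound the inverses near \<open>A\<close>. That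
  bound comes from \<open>X\<inverse> = A\<inverse> - A\<inverse> (X - A) X\<inverse>\<close>, where for \<open>X\<close> close to \<open>A\<close> the last term is at
  most half of \<open>X\<inverse>\<close> in norm.\<close>

lemma lipschitz_near_matrix_inv:
  fixes A :: "real^'m^'m"
  assumes A: "invertible A"
  shows "lipschitz_near matrix_inv A"
proof -
  note bb = bounded_bilinear_matrix_mult[where 'm = 'm and 'n = 'm and 'k = 'm]
  note diff_left = bounded_bilinear.diff_left[OF bb] and diff_right = bounded_bilinear.diff_right[OF bb]
  obtain K where K: "K > 0" "\<And>(a :: real^'m^'m) (b :: real^'m^'m). norm (a ** b) \<le> norm a * norm b * K"
    using bounded_bilinear.pos_bounded[OF bb] by metis
  define \<beta> where "\<beta> = norm (matrix_inv A)"
  have "continuous_on UNIV (det :: real^'m^'m \<Rightarrow> real)"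
    by (intro continuous_at_imp_continuous_on ballI isCont_det)
  then have "open {X :: real^'m^'m. det X \<noteq> 0}"
    by (rule open_Collect_neq[OF _ continuous_on_const])
  moreover have "det A \<noteq> 0" using A by (simp add: invertible_det_nz)
  ultimately obtain e where e: "e > 0" "\<And>X. X \<in> ball A e \<Longrightarrow> det X \<noteq> 0"
    using openE[of "{X :: real^'m^'m. det X \<noteq> 0}" A] by (auto simp: subset_iff)
  define r where "r = min (e / 2) (1 / (2 * (\<beta> * K * K + 1)))"
  have \<beta>: "\<beta> \<ge> 0" by (simp add: \<beta>_def)
  have r: "r > 0" using e K \<beta> by (auto simp: r_def intro!: divide_pos_pos add_nonneg_pos)
  have inv: "invertible X" if "X \<in> cball A r" for X
    using that e r by (auto simp: invertible_det_nz r_def)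
  have bound: "norm (matrix_inv X) \<le> 2 * \<beta>" if X: "X \<in> cball A r" for X
  proof -
    have "matrix_inv X = matrix_inv A ** A ** matrix_inv X"
      using matrix_inv_mult[OF A] by simp
    also have "\<dots> = matrix_inv A ** (X ** matrix_inv X) - matrix_inv A ** ((X - A) ** matrix_inv X)"
      by (simp add: diff_left diff_right matrix_mul_assoc)
    also have "X ** matrix_inv X = mat 1" using matrix_inv_mult[OF inv[OF X]] by simp
    finally have "norm (matrix_inv X) \<le> norm (matrix_inv A) + norm (matrix_inv A ** ((X - A) ** matrix_inv X))"
      by (metis matrix_mul_rid norm_triangle_ineq4)
    also have "norm (matrix_inv A ** ((X - A) ** matrix_inv X)) \<le> \<beta> * (norm (X - A) * norm (matrix_inv X) * K) * K"
      unfolding \<beta>_def using K by (intro order_trans[OF K(2)] mult_right_mono mult_left_mono) auto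
    also have "\<dots> = (\<beta> * K * K * norm (X - A)) * norm (matrix_inv X)" by simp
    also have "\<dots> \<le> (1 / 2) * norm (matrix_inv X)"
    proof (rule mult_right_mono)
      have "\<beta> * K * K * norm (X - A) \<le> \<beta> * K * K * (1 / (2 * (\<beta> * K * K + 1)))"
        using X \<beta> K by (intro mult_left_mono) (auto simp: r_def dist_norm norm_minus_commute)
      also have "\<dots> \<le> 1 / 2" using \<beta> K by (simp add: divide_simps add_nonneg_pos)
      finally show "\<beta> * K * K * norm (X - A) \<le> 1 / 2" .
    qed simp
    finally show ?thesis by (simp add: \<beta>_def)
  qed
  have "((2 * \<beta>) * (2 * \<beta>) * K * K)-lipschitz_on (cball A r) matrix_inv"
  proof (rule lipschitz_onI)
    fix X Y assume X: "X \<in> cball A r" and Y: "Y \<in> cball A r"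
    have "matrix_inv X ** ((Y - X) ** matrix_inv Y)
        = matrix_inv X ** (Y ** matrix_inv Y) - (matrix_inv X ** X) ** matrix_inv Y"
      by (simp add: diff_left diff_right matrix_mul_assoc)
    also have "\<dots> = matrix_inv X - matrix_inv Y"
      using matrix_inv_mult[OF inv[OF X]] matrix_inv_mult[OF inv[OF Y]] by simp
    finally have "norm (matrix_inv X - matrix_inv Y) = norm (matrix_inv X ** ((Y - X) ** matrix_inv Y))"
      by simp
    also have "\<dots> \<le> (2 * \<beta>) * (norm (Y - X) * (2 * \<beta>) * K) * K"
    proof -
      have 1: "norm ((Y - X) ** matrix_inv Y) \<le> norm (Y - X) * (2 * \<beta>) * K"
        using K(1) bound[OF Y] by (intro order_trans[OF K(2)] mult_right_mono mult_left_mono) auto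
      show ?thesis
        using K(1) \<beta> by (intro order_trans[OF K(2)] mult_right_mono mult_mono 1 bound[OF X]) auto
    qed
    finally show "dist (matrix_inv X) (matrix_inv Y) \<le> (2 * \<beta>) * (2 * \<beta>) * K * K * dist X Y"
      by (simp add: dist_norm norm_minus_commute mult_ac)
  qed (use \<beta> K in auto)
  with r show ?thesis unfolding lipschitz_near_def by blast
qed

section \<open>Determinants, quadratic forms and eigenvalues of real matrices\<close>

text \<open>In the Leibniz formula only the identity permutation contributes: any other permutation produces
  at least two off-diagonal factors, and differentiating one of them leaves a factor that vanishes
  at the identity matrix.\<close>

lemma has_derivative_det_mat_1:
  "((det :: real^'m^'m \<Rightarrow> real) has_derivative trace) (at (mat 1))"
proof -
  let ?P = "{p. p permutes (UNIV :: 'm set)}"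
  let ?I = "mat 1 :: real^'m^'m"
  have entry: "((\<lambda>A :: real^'m^'m. A $ i $ j) has_derivative (\<lambda>Y. Y $ i $ j)) (at ?I)" for i j
    by (intro bounded_linear_imp_has_derivative) (auto intro!: bounded_linear_compose[OF bounded_linear_vec_nth] bounded_linear_vec_nth)
  have "((\<lambda>A :: real^'m^'m. \<Sum>p\<in>?P. of_int (sign p) * (\<Prod>i\<in>UNIV. A $ i $ p i)) has_derivative
      (\<lambda>Y. \<Sum>p\<in>?P. of_int (sign p) * (\<Sum>i\<in>UNIV. Y $ i $ p i * (\<Prod>j\<in>UNIV - {i}. ?I $ j $ p j)))) (at ?I)"
    by (intro has_derivative_sum has_derivative_mult_right has_derivative_prod entry)
  moreover have "(\<Sum>p\<in>?P. of_int (sign p) * (\<Sum>i\<in>UNIV. Y $ i $ p i * (\<Prod>j\<in>UNIV - {i}. ?I $ j $ p j))) = trace Y"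
    for Y :: "real^'m^'m"
  proof -
    have zero: "(\<Prod>j\<in>UNIV - {i}. ?I $ j $ p j) = 0" if p: "p permutes UNIV" "p \<noteq> id" for i p
    proof -
      \<comment> \<open>A permutation other than the identity moves at least two points.\<close>
      have "\<exists>j. j \<noteq> i \<and> p j \<noteq> j"
      proof (rule ccontr)
        assume "\<not> ?thesis"
        then have others: "p j = j" if "j \<noteq> i" for j using that by blast
        then have "p i = i" by (metis p(1) permutes_def)
        then have "p j = j" for j by (cases "j = i") (simp_all add: others)
        then have "p = id" by (simp add: fun_eq_iff)
        with p(2) show False ..
      qed
      then obtain j where "j \<noteq> i" "p j \<noteq> j" by blast
      then show ?thesis by (intro prod_zero bexI[of _ j]) (auto simp: mat_def)
    qed
    have "(\<Sum>p\<in>?P. of_int (sign p) * (\<Sum>i\<in>UNIV. Y $ i $ p i * (\<Prod>j\<in>UNIV - {i}. ?I $ j $ p j)))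
      = (\<Sum>p\<in>{id}. of_int (sign p) * (\<Sum>i\<in>UNIV. Y $ i $ p i * (\<Prod>j\<in>UNIV - {i}. ?I $ j $ p j)))"
      by (rule sum.mono_neutral_right) (auto simp: zero permutes_id finite_permutations)
    also have "\<dots> = trace Y" by (simp add: trace_def mat_def sign_id)
    finally show ?thesis .
  qed
  ultimately show ?thesis unfolding det_def by (simp add: fun_eq_iff)
qed

text \<open>The factorisation \<open>det X = det (H t) * det ((H t)\<inverse> ** X)\<close> reduces the claim to the derivative at
  the identity matrix.\<close>

lemma jacobi_formula:
  fixes H :: "real \<Rightarrow> real^'m^'m"
  assumes inv: "invertible (H t)" and H: "(H has_vector_derivative H') (at t)"
  shows "((\<lambda>s. det (H s)) has_real_derivative det (H t) * trace (matrix_inv (H t) ** H')) (at t)"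
proof -
  let ?P = "matrix_inv (H t)"
  have 1: "bounded_linear (\<lambda>X :: real^'m^'m. ?P ** X)"
    by (rule bounded_bilinear.bounded_linear_right[OF bounded_bilinear_matrix_mult])
  have "((\<lambda>s. ?P ** H s) has_vector_derivative ?P ** H') (at t)"
    by (rule bounded_linear.has_vector_derivative[OF 1 H])
  then have "((\<lambda>s. ?P ** H s) has_derivative (\<lambda>x. x *\<^sub>R (?P ** H'))) (at t)"
    by (simp add: has_vector_derivative_def)
  moreover have "(det has_derivative trace) (at (?P ** H t))"
    using has_derivative_det_mat_1 matrix_inv_mult[OF inv] by simp
  ultimately have "((\<lambda>s. det (?P ** H s)) has_derivative (\<lambda>x. trace (x *\<^sub>R (?P ** H')))) (at t)"
    by (rule has_derivative_compose)
  then have "((\<lambda>s. det (?P ** H s)) has_real_derivative trace (?P ** H')) (at t)"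
    unfolding has_field_derivative_def
    by (rule has_derivative_eq_rhs) (simp add: fun_eq_iff trace_def sum_distrib_left[symmetric])
  then have "((\<lambda>s. det (H t) * det (?P ** H s)) has_real_derivative det (H t) * trace (?P ** H')) (at t)"
    by (rule DERIV_cmult)
  moreover have "det (H t) * det (?P ** X) = det X" for X
    unfolding det_mul[symmetric] matrix_mul_assoc matrix_inv_mult[OF inv] by simp
  ultimately show ?thesis by simp
qed

lemma norm_matrix_vector_mult_le:
  fixes A :: "real^'n^'m"
  shows "norm (A *v x) \<le> norm A * norm x"
proof -
  have "(norm (A *v x))\<^sup>2 = (\<Sum>i\<in>UNIV. (A $ i \<bullet> x)\<^sup>2)"
    unfolding power2_norm_eq_inner inner_vec_def[of "A *v x"]
    by (simp add: matrix_mult_dot power2_eq_square)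
  also have "\<dots> \<le> (\<Sum>i\<in>UNIV. (A $ i \<bullet> A $ i) * (x \<bullet> x))"
    by (intro sum_mono Cauchy_Schwarz_ineq)
  also have "\<dots> = (norm A * norm x)\<^sup>2"
    by (simp add: power_mult_distrib power2_norm_eq_inner inner_vec_def[of A] sum_distrib_right)
  finally show ?thesis by (rule power2_le_imp_le) simp
qed

lemma norm_transpose: "norm (transpose A) = norm (A :: real^'n^'m)"
proof -
  have "(\<Sum>i\<in>UNIV. \<Sum>j\<in>UNIV. A $ j $ i * A $ j $ i) = (\<Sum>j\<in>UNIV. \<Sum>i\<in>UNIV. A $ j $ i * A $ j $ i)"
    by (rule sum.swap)
  then show ?thesis by (simp add: norm_eq_sqrt_inner inner_vec_def transpose_def)
qed

lemma trace_mult_transpose: "trace (A ** transpose B) = A \<bullet> (B :: real^'m^'m)"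
  by (simp add: trace_def matrix_matrix_mult_def transpose_def inner_vec_def)

text \<open>The norm is the Frobenius norm, and \<open>trace (A ** A)\<close> is the inner product of \<open>A\<close> with its
  transpose.\<close>

lemma trace_mult_self_ge: "trace (A ** A) \<ge> - (norm (A :: real^'m^'m))\<^sup>2"
proof -
  have "\<bar>A \<bullet> transpose A\<bar> \<le> norm A * norm (transpose A)" by (rule Cauchy_Schwarz_ineq2)
  then show ?thesis
    using trace_mult_transpose[of A "transpose A"] by (simp add: norm_transpose power2_eq_square)
qed

lemma quadratic_form_plus:
  fixes H :: "real^'m^'m"
  assumes "transpose H = H"
  shows "(v + c *\<^sub>R w) \<bullet> (H *v (v + c *\<^sub>R w))
    = v \<bullet> (H *v v) + 2 * c * (w \<bullet> (H *v v)) + c\<^sup>2 * (w \<bullet> (H *v w))"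
proof -
  have "v \<bullet> (H *v w) = w \<bullet> (H *v v)"
    by (metis assms dot_lmul_matrix inner_commute transpose_matrix_vector)
  then show ?thesis
    by (simp add: matrix_vector_right_distrib matrix_vector_mult_scaleR inner_add_left inner_add_right
        power2_eq_square algebra_simps)
qed

lemma quadratic_form_axis:
  fixes H :: "real^'m^'m"
  shows "axis s 1 \<bullet> (H *v v) = (H *v v) $ s" "axis s 1 \<bullet> (H *v axis j 1) = H $ s $ j"
  by (simp_all add: inner_axis' matrix_vector_mult_basis column_def)

text \<open>This is the Cholesky decomposition: a row with positive diagonal entry is split off by completing
  the square, and a row with zero diagonal entry vanishes by semidefiniteness. The set \<open>S\<close> of rows
  still to be treated makes the induction possible with a fixed index type.\<close>

lemma semidefinite_is_sum_of_squares:
  fixes H :: "real^'m^'m"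
  assumes "finite S" "transpose H = H" "\<And>v. v \<bullet> (H *v v) \<ge> 0"
    and "\<And>i j. i \<notin> S \<Longrightarrow> H $ i $ j = 0"
  shows "\<exists>b :: 'm \<Rightarrow> real^'m. \<forall>i j. H $ i $ j = (\<Sum>k\<in>S. b k $ i * b k $ j)"
  using assms
proof (induction S arbitrary: H rule: finite_induct)
  case empty
  then show ?case by simp
next
  case (insert s S)
  have sym: "H $ i $ j = H $ j $ i" for i j
    using arg_cong[OF insert.prems(1), of "\<lambda>X. X $ j $ i"] by (simp add: transpose_def)
  have row: "(H *v v) $ s = (\<Sum>i\<in>UNIV. H $ s $ i * v $ i)" for v
    by (simp add: matrix_vector_mult_def)
  show ?case
  proof (cases "H $ s $ s = 0")
    case True
    have "H $ s $ j = 0" for j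
    proof (rule ccontr)
      assume nz: "H $ s $ j \<noteq> 0"
      \<comment> \<open>With \<open>H $ s $ s = 0\<close> the form is affine along \<open>axis s 1\<close>; this \<open>c\<close> makes its value \<open>- 1\<close>.\<close>
      define c where "c = - (H $ j $ j + 1) / (2 * H $ s $ j)"
      have "0 \<le> (axis j 1 + c *\<^sub>R axis s 1) \<bullet> (H *v (axis j 1 + c *\<^sub>R axis s 1))"
        by (rule insert.prems(2))
      also have "\<dots> = H $ j $ j + 2 * c * H $ s $ j"
        by (simp add: quadratic_form_plus[OF insert.prems(1)] quadratic_form_axis(2) True)
      also have "\<dots> = - 1" using nz by (simp add: c_def field_simps)
      finally show False by simp
    qed
    then have "H $ i $ j = 0" if "i \<notin> S" for i j
      using insert.prems(3)[of i j] that by (cases "i = s") auto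
    from insert.IH[OF insert.prems(1,2) this] obtain b :: "'m \<Rightarrow> real^'m"
      where b: "\<forall>i j. H $ i $ j = (\<Sum>k\<in>S. b k $ i * b k $ j)" by blast
    have "(\<Sum>k\<in>insert s S. (b(s := 0)) k $ i * (b(s := 0)) k $ j) = H $ i $ j" for i j
    proof -
      have "(\<Sum>k\<in>S. (b(s := 0)) k $ i * (b(s := 0)) k $ j) = (\<Sum>k\<in>S. b k $ i * b k $ j)"
        using insert.hyps by (intro sum.cong) auto
      then show ?thesis using insert.hyps b by simp
    qed
    then show ?thesis by (intro exI[of _ "b(s := 0)"]) simp
  next
    case False
    let ?d = "H $ s $ s"
    have d: "?d > 0"
      using insert.prems(2)[of "axis s 1"] False by (simp add: quadratic_form_axis(2))
    define K where "K = (\<chi> i j. H $ i $ j - H $ s $ i * H $ s $ j / ?d)"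
    have Kv: "K *v v = H *v v - ((H *v v) $ s / ?d) *\<^sub>R H $ s" for v
      by (simp add: vec_eq_iff K_def matrix_vector_mult_def right_diff_distrib sum_subtractf
          sum_distrib_left sum_divide_distrib mult_ac)
    have quad: "v \<bullet> (K *v v) = v \<bullet> (H *v v) - ((H *v v) $ s)\<^sup>2 / ?d" for v
    proof -
      have "v \<bullet> H $ s = (H *v v) $ s" by (simp add: matrix_mult_dot inner_commute)
      then show ?thesis by (simp add: Kv inner_diff_right power2_eq_square)
    qed
    have "transpose K = K"
      by (simp add: vec_eq_iff transpose_def K_def sym mult.commute)
    moreover have "v \<bullet> (K *v v) \<ge> 0" for v
    proof -
      \<comment> \<open>This \<open>c\<close> minimises the form of \<open>H\<close> on the line through \<open>v\<close> in direction \<open>axis s 1\<close>.\<close>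
      define c where "c = - ((H *v v) $ s) / ?d"
      have "0 \<le> (v + c *\<^sub>R axis s 1) \<bullet> (H *v (v + c *\<^sub>R axis s 1))"
        by (rule insert.prems(2))
      also have "\<dots> = v \<bullet> (H *v v) + 2 * c * (H *v v) $ s + c\<^sup>2 * ?d"
        by (simp only: quadratic_form_plus[OF insert.prems(1)] quadratic_form_axis(1))
          (simp add: matrix_vector_mult_basis column_def)
      also have "\<dots> = v \<bullet> (K *v v)"
        unfolding quad c_def using d by (simp add: field_simps power2_eq_square)
      finally show ?thesis .
    qed
    moreover have "K $ i $ j = 0" if "i \<notin> S" for i j
    proof (cases "i = s")
      case True then show ?thesis using d by (simp add: K_def)
    next
      case False
      then have "H $ i $ k = 0" for k using insert.prems(3) that by blast
      then show ?thesis using sym[of s i] by (simp add: K_def)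
    qed
    ultimately obtain b :: "'m \<Rightarrow> real^'m"
      where b: "\<forall>i j. K $ i $ j = (\<Sum>k\<in>S. b k $ i * b k $ j)" using insert.IH by blast
    define b' where "b' = b(s := (1 / sqrt ?d) *\<^sub>R H $ s)"
    have "(\<Sum>k\<in>insert s S. b' k $ i * b' k $ j) = H $ i $ j" for i j
    proof -
      have "(\<Sum>k\<in>S. b' k $ i * b' k $ j) = (\<Sum>k\<in>S. b k $ i * b k $ j)"
        using insert.hyps by (intro sum.cong) (auto simp: b'_def)
      moreover have "b' s $ i * b' s $ j = H $ s $ i * H $ s $ j / ?d"
        using d by (simp add: b'_def)
      ultimately show ?thesis using insert.hyps b[rule_format, of i j, symmetric] by (simp add: K_def)
    qed
    then show ?thesis by (intro exI[of _ b']) simp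
  qed
qed

text \<open>The matrix \<open>B\<close> expresses vectors in a basis that is orthonormal for the inner product given by
  \<open>H\<close>; the matrix \<open>C\<close> is its inverse.\<close>

lemma Sym_plus_frame:
  fixes H :: "real^'m^'m"
  assumes H: "H \<in> Sym_plus"
  obtains B C :: "real^'m^'m" where "transpose B ** B = H" "B ** C = mat 1" "C ** B = mat 1"
    "matrix_inv H = C ** transpose C"
proof -
  have sym: "transpose H = H" and pos: "\<And>v. v \<noteq> 0 \<Longrightarrow> v \<bullet> (H *v v) > 0"
    using H by (auto simp: Sym_plus_def)
  have psd: "v \<bullet> (H *v v) \<ge> 0" for v
    using pos[of v] by (cases "v = 0") (auto simp: less_imp_le)
  obtain b :: "'m \<Rightarrow> real^'m" where b: "\<forall>i j. H $ i $ j = (\<Sum>k\<in>UNIV. b k $ i * b k $ j)"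
    using semidefinite_is_sum_of_squares[OF finite_class.finite_UNIV sym psd] by blast
  define B where "B = (\<chi> k. b k)"
  have BB: "transpose B ** B = H"
    by (simp add: vec_eq_iff matrix_matrix_mult_def transpose_def B_def b)
  have "v = 0" if "B *v v = 0" for v
  proof (rule ccontr)
    assume "v \<noteq> 0"
    moreover have "H *v v = 0" unfolding BB[symmetric] matrix_vector_mul_assoc[symmetric] that by simp
    ultimately show False using pos[of v] by simp
  qed
  then obtain C where CB: "C ** B = mat 1" using matrix_left_invertible_ker[of B] by blast
  then have BC: "B ** C = mat 1" by (simp add: matrix_left_right_inverse)
  have TC: "transpose C ** transpose B = mat 1" "transpose B ** transpose C = mat 1"
    using arg_cong[OF BC, of transpose] arg_cong[OF CB, of transpose]
    by (simp_all add: matrix_transpose_mul transpose_mat)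
  have "C ** transpose C ** H = C ** (transpose C ** transpose B) ** B"
    unfolding BB[symmetric] by (simp add: matrix_mul_assoc)
  then have l: "C ** transpose C ** H = mat 1" by (simp add: TC CB)
  then have r: "H ** (C ** transpose C) = mat 1" by (simp add: matrix_left_right_inverse)
  have "invertible H" using l r by (auto simp: invertible_def)
  then have "H ** matrix_inv H = mat 1"
    by (rule matrix_inv_mult)
  then have "(C ** transpose C ** H) ** matrix_inv H = C ** transpose C"
    by (metis matrix_mul_assoc matrix_mul_rid)
  then have "matrix_inv H = C ** transpose C" by (simp add: l)
  with that BB BC CB show thesis by blast
qed

lemma dependent_family:
  fixes f :: "nat \<Rightarrow> 'a::euclidean_space"
  shows "\<exists>c. (\<exists>i\<le>DIM('a). c i \<noteq> 0) \<and> (\<Sum>i\<le>DIM('a). c i *\<^sub>R f i) = 0"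
proof (cases "inj_on f {..DIM('a)}")
  case True
  have "dependent (f ` {..DIM('a)})"
    using dependent_biggerset[of "f ` {..DIM('a)}"] True by (simp add: card_image)
  then obtain u where u: "\<exists>v\<in>f ` {..DIM('a)}. u v \<noteq> 0" "(\<Sum>v\<in>f ` {..DIM('a)}. u v *\<^sub>R v) = 0"
    using dependent_finite[of "f ` {..DIM('a)}"] by auto
  then show ?thesis
    by (intro exI[of _ "u \<circ> f"]) (auto simp: sum.reindex[OF True])
next
  case False
  then obtain i j where ij: "i \<le> DIM('a)" "j \<le> DIM('a)" "i \<noteq> j" "f i = f j"
    by (auto simp: inj_on_def)
  define c :: "nat \<Rightarrow> real" where "c = (\<lambda>k. (if k = i then 1 else 0) - (if k = j then 1 else 0))"
  have "(\<Sum>k\<le>DIM('a). c k *\<^sub>R f k) = (\<Sum>k\<le>DIM('a). (if k = i then f k else 0) - (if k = j then f k else 0))"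
    by (intro sum.cong) (auto simp: c_def)
  also have "\<dots> = 0" using ij by (simp add: sum_subtractf)
  finally show ?thesis using ij by (intro exI[of _ c]) (auto simp: c_def)
qed

text \<open>Among all nonzero polynomials \<open>p\<close> for which \<open>p(A)\<close> kills some vector \<open>A\<^sup>k v\<close>, take one of minimal
  degree, and let \<open>\<mu>\<close> be one of its roots, so that \<open>p = (X - \<mu>) q\<close>. By minimality \<open>u = q(A) A\<^sup>k v\<close> is
  nonzero, hence an eigenvector for \<open>\<mu>\<close>. If \<open>\<mu>\<close> were zero, then \<open>q(A)\<close> would kill \<open>A\<^sup>k\<^sup>+\<^sup>1 v\<close>, against
  minimality.\<close>

lemma nonzero_eigenvalue:
  fixes A :: "complex^'m^'m"
  assumes nz: "\<And>k. ((*v) A ^^ k) v \<noteq> 0"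
  obtains \<mu> u where "\<mu> \<noteq> 0" "u \<noteq> 0" "A *v u = \<mu> *s u"
proof -
  define T where "T = (*v) A"
  have T_add: "T (x + y) = T x + T y" and T_scale: "T (c *s x) = c *s T x" for c x y
    by (simp_all add: T_def matrix_vector_right_distrib vector_scalar_commute)
  have T0: "T 0 = 0" by (simp add: T_def)
  have T_sum: "T (\<Sum>i\<in>I. g i) = (\<Sum>i\<in>I. T (g i))" if "finite I" for I :: "nat set" and g
    using that by (induction I rule: finite_induct) (simp_all add: T_add T0)
  \<comment> \<open>\<open>E p w\<close> is the polynomial \<open>p\<close> evaluated at \<open>A\<close> and applied to \<open>w\<close>.\<close>
  define E where "E = (\<lambda>p w. \<Sum>i\<le>degree p. coeff p i *s (T ^^ i) w)"
  define Q where "Q = (\<lambda>d. \<exists>p k. p \<noteq> 0 \<and> degree p = d \<and> E p ((T ^^ k) v) = 0)"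
  have "\<exists>d. Q d"
  proof -
    let ?N = "DIM(complex^'m)"
    obtain c where c: "\<exists>i\<le>?N. c i \<noteq> 0" "(\<Sum>i\<le>?N. c i *\<^sub>R (T ^^ i) v) = 0"
      using dependent_family[of "\<lambda>i. (T ^^ i) v"] by blast
    define p where "p = (\<Sum>i\<le>?N. monom (complex_of_real (c i)) i)"
    have cp: "coeff p i = (if i \<le> ?N then of_real (c i) else 0)" for i
      by (simp add: p_def coeff_sum)
    have "p \<noteq> 0" using c(1) cp by (metis coeff_0 of_real_eq_0_iff)
    moreover have "E p v = 0"
    proof -
      have "degree p \<le> ?N" by (rule degree_le) (simp add: cp)
      then have "E p v = (\<Sum>i\<le>?N. coeff p i *s (T ^^ i) v)"
        unfolding E_def by (intro sum.mono_neutral_left) (auto simp: coeff_eq_0)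
      also have "\<dots> = (\<Sum>i\<le>?N. c i *\<^sub>R (T ^^ i) v)"
        by (intro sum.cong) (auto simp: cp vec_eq_iff scaleR_conv_of_real[where 'a = complex])
      finally show ?thesis using c(2) by simp
    qed
    ultimately have "Q (degree p)"
      unfolding Q_def by (intro exI[of _ p] exI[of _ 0]) simp
    then show ?thesis ..
  qed
  define d where "d = (LEAST d. Q d)"
  have "Q d" unfolding d_def using \<open>\<exists>d. Q d\<close> by (rule LeastI_ex)
  then obtain p k where p: "p \<noteq> 0" "degree p = d" "E p ((T ^^ k) v) = 0"
    unfolding Q_def by blast
  have min: "E q ((T ^^ j) v) \<noteq> 0" if "q \<noteq> 0" "degree q < d" for q j
    using that not_less_Least[of "degree q" Q] unfolding d_def Q_def by blast
  let ?w = "(T ^^ k) v"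
  have "d \<noteq> 0"
  proof
    assume "d = 0"
    then have "coeff p 0 *s ?w = 0" "coeff p 0 \<noteq> 0"
      using p leading_coeff_0_iff[of p] by (auto simp: E_def)
    then show False using nz[of k] by (simp add: T_def)
  qed
  then have "\<not> constant (poly p)" using p(2) by (simp add: constant_degree)
  then obtain \<mu> where "poly p \<mu> = 0" using fundamental_theorem_of_algebra by blast
  then obtain q where q: "p = [:- \<mu>, 1:] * q" by (meson dvdE poly_eq_0_iff_dvd)
  then have q0: "q \<noteq> 0" using p(1) by auto
  have dq: "degree p = Suc (degree q)" using q0 unfolding q by (subst degree_mult_eq) auto
  have cp: "coeff p i = (case i of 0 \<Rightarrow> 0 | Suc j \<Rightarrow> coeff q j) - \<mu> * coeff q i" for i
    unfolding q by (simp add: coeff_pCons split: nat.split)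
  have E_p: "E p w = T (E q w) - \<mu> *s E q w" for w
  proof -
    have "E p w = (\<Sum>i\<le>Suc (degree q). (case i of 0 \<Rightarrow> 0 | Suc j \<Rightarrow> coeff q j) *s (T ^^ i) w)
        - (\<Sum>i\<le>Suc (degree q). (\<mu> * coeff q i) *s (T ^^ i) w)"
      unfolding E_def dq cp by (simp only: vector_sub_rdistrib sum_subtractf)
    also have "(\<Sum>i\<le>Suc (degree q). (case i of 0 \<Rightarrow> 0 | Suc j \<Rightarrow> coeff q j) *s (T ^^ i) w) = T (E q w)"
      unfolding sum.atMost_Suc_shift by (simp add: E_def T_sum T_scale)
    also have "(\<Sum>i\<le>Suc (degree q). (\<mu> * coeff q i) *s (T ^^ i) w) = \<mu> *s E q w"
      by (simp add: E_def coeff_eq_0 vec_eq_iff sum_distrib_left mult.assoc)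
    finally show ?thesis .
  qed
  have u: "E q ?w \<noteq> 0" using min[OF q0] dq p(2) by simp
  have eig: "T (E q ?w) = \<mu> *s E q ?w" using p(3) by (simp add: E_p)
  have "\<mu> \<noteq> 0"
  proof
    assume "\<mu> = 0"
    then have "T (E q ?w) = 0" using eig by simp
    moreover have "T (E q ?w) = E q ((T ^^ Suc k) v)"
      by (simp add: E_def T_sum T_scale funpow_swap1)
    ultimately show False using min[OF q0, of "Suc k"] dq p(2) by simp
  qed
  then show thesis using that[of \<mu> "E q ?w"] u eig by (simp add: T_def)
qed

text \<open>These equations are the real and imaginary parts of the eigenvalue equation for the vector
  \<open>x + \<i> y\<close> and the eigenvalue \<open>a + \<i> b\<close> of the complexification of \<open>F\<close>.\<close>

lemma nonzero_complex_eigenvalue: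
  fixes F :: "real^'m^'m"
  assumes nz: "\<And>k. ((*v) F ^^ k) v \<noteq> 0"
  obtains a b :: real and x y :: "real^'m" where "a\<^sup>2 + b\<^sup>2 > 0" "x \<noteq> 0 \<or> y \<noteq> 0"
    "F *v x = a *\<^sub>R x - b *\<^sub>R y" "F *v y = b *\<^sub>R x + a *\<^sub>R y"
proof -
  define A :: "complex^'m^'m" where "A = (\<chi> i j. of_real (F $ i $ j))"
  define cx :: "real^'m \<Rightarrow> complex^'m" where "cx = (\<lambda>w. \<chi> i. of_real (w $ i))"
  have A_cx: "A *v cx w = cx (F *v w)" for w
    by (simp add: A_def cx_def vec_eq_iff matrix_vector_mult_def)
  have "((*v) A ^^ k) (cx v) = cx (((*v) F ^^ k) v)" for k
    by (induction k) (simp_all add: A_cx)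
  moreover have "cx w \<noteq> 0" if "w \<noteq> 0" for w using that by (auto simp: cx_def vec_eq_iff)
  ultimately have "((*v) A ^^ k) (cx v) \<noteq> 0" for k using nz by metis
  then obtain \<mu> u where u: "\<mu> \<noteq> 0" "u \<noteq> 0" "A *v u = \<mu> *s u" by (rule nonzero_eigenvalue)
  define x y where "x = (\<chi> i. Re (u $ i))" and "y = (\<chi> i. Im (u $ i))"
  have Au: "(\<Sum>j\<in>UNIV. of_real (F $ i $ j) * u $ j) = \<mu> * u $ i" for i
    using arg_cong[OF u(3), of "\<lambda>w. w $ i"] by (simp add: A_def matrix_vector_mult_def)
  have "F *v x = Re \<mu> *\<^sub>R x - Im \<mu> *\<^sub>R y"
    using arg_cong[OF Au, of Re] by (simp add: vec_eq_iff matrix_vector_mult_def x_def y_def)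
  moreover have "F *v y = Im \<mu> *\<^sub>R x + Re \<mu> *\<^sub>R y"
    using arg_cong[OF Au, of Im] by (simp add: vec_eq_iff matrix_vector_mult_def x_def y_def)
  moreover have "(Re \<mu>)\<^sup>2 + (Im \<mu>)\<^sup>2 > 0" using u(1) by (simp add: complex_neq_0)
  moreover have "x \<noteq> 0 \<or> y \<noteq> 0" using u(2) by (auto simp: vec_eq_iff x_def y_def complex_eq_iff)
  ultimately show thesis using that by blast
qed

section \<open>The vector field of the flow\<close>

text \<open>The spinor flow has \<open>\<alpha> = 1\<close> and \<open>\<beta> = 1 / 64\<close>; its normalisation in dimension \<open>n\<close> has
  \<open>\<alpha> = 2 / n\<close> and \<open>\<beta> = (n - 1) / (32 n)\<close>.\<close>

definition scaled_flow ::
  "real \<Rightarrow> real \<Rightarrow> real^'m^'m \<Rightarrow> (real^'m^'m) \<times> real \<Rightarrow> (real^'m^'m) \<times> real" where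
  "scaled_flow \<alpha> \<beta> F = (\<lambda>(H, h).
     (- (1 / (64 * h)) *\<^sub>R ((\<alpha> * flow_scalar F H) *\<^sub>R H + flow_tensor F H), \<beta> * flow_scalar F H))"

lemma inner_transpose: "v \<bullet> (transpose A *v w) = (A *v v) \<bullet> (w :: real^'m)" for A :: "real^'m^'m"
  by (metis dot_lmul_matrix inner_commute transpose_matrix_vector)

lemma gram_quadratic_form: "v \<bullet> (transpose P ** P *v v) = (norm (P *v v))\<^sup>2" for P :: "real^'m^'m"
  by (simp only: matrix_vector_mul_assoc[symmetric] inner_transpose power2_norm_eq_inner)

text \<open>In an orthonormal basis for \<open>H\<close> the endomorphism \<open>F\<close> becomes \<open>A = B F B\<inverse>\<close>, the trace
  \<open>tr (H F H\<inverse> F\<^sup>T)\<close> becomes the squared norm of \<open>A\<close>, and the flow tensor becomes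
  \<open>6 (A A\<^sup>T - A\<^sup>T A)\<close>.\<close>

lemma flow_in_frame:
  fixes F H :: "real^'m^'m"
  assumes H: "H \<in> Sym_plus"
  obtains A B C :: "real^'m^'m" where
    "B ** C = mat 1" "C ** B = mat 1" "transpose B ** B = H"
    "\<And>v. v \<bullet> (H *v v) = (norm (B *v v))\<^sup>2"
    "\<And>v. B *v (F *v v) = A *v (B *v v)"
    "flow_scalar F H = 3 * (norm A)\<^sup>2 + trace (A ** A)"
    "\<And>v. v \<bullet> (flow_tensor F H *v v)
      = 6 * (norm (transpose A *v (B *v v)))\<^sup>2 - 6 * (norm (A *v (B *v v)))\<^sup>2"
proof -
  obtain B C :: "real^'m^'m" where BB: "transpose B ** B = H" and BC: "B ** C = mat 1" and CB: "C ** B = mat 1"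
    and inv: "matrix_inv H = C ** transpose C"
    using H by (rule Sym_plus_frame)
  define A where "A = B ** F ** C"
  have XCB: "X ** C ** B = X" for X using CB by (metis matrix_mul_assoc matrix_mul_rid)
  have AT: "transpose A = transpose C ** transpose F ** transpose B"
    by (simp add: A_def matrix_transpose_mul matrix_mul_assoc)
  have TBC: "transpose C ** transpose B = mat 1" "transpose B ** transpose C = mat 1"
    using arg_cong[OF BC, of transpose] arg_cong[OF CB, of transpose]
    by (simp_all add: matrix_transpose_mul transpose_mat)
  have AB: "A ** B = B ** F" unfolding A_def by (rule XCB)
  have AATB: "transpose B ** A ** transpose A ** B = H ** F ** matrix_inv H ** transpose F ** H"
    unfolding AT inv unfolding BB[symmetric] by (simp add: A_def matrix_mul_assoc)
  note quad = gram_quadratic_form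
  have 1: "v \<bullet> (H *v v) = (norm (B *v v))\<^sup>2" for v
    unfolding BB[symmetric] by (rule quad)
  have 2: "B *v (F *v v) = A *v (B *v v)" for v
    by (simp add: matrix_vector_mul_assoc AB)
  have 3: "flow_scalar F H = 3 * (norm A)\<^sup>2 + trace (A ** A)"
  proof -
    have "trace (H ** F ** matrix_inv H ** transpose F)
        = trace (transpose B ** (B ** F ** C ** transpose C ** transpose F))"
      unfolding inv unfolding BB[symmetric] by (simp add: matrix_mul_assoc)
    also have "\<dots> = trace (A ** transpose A)"
      unfolding AT by (subst trace_mul_sym) (simp add: A_def matrix_mul_assoc)
    also have "\<dots> = (norm A)\<^sup>2" by (simp add: trace_mult_transpose power2_norm_eq_inner)
    finally have a: "trace (H ** F ** matrix_inv H ** transpose F) = (norm A)\<^sup>2" .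
    have "A ** A = B ** (F ** F ** C)"
      unfolding A_def by (simp add: matrix_mul_assoc XCB)
    then have "trace (A ** A) = trace (F ** F ** C ** B)" by (simp add: trace_mul_sym[of B])
    then have "trace (A ** A) = trace (F ** F)" by (simp add: XCB)
    with a show ?thesis by (simp add: flow_scalar_def)
  qed
  have 4: "v \<bullet> (flow_tensor F H *v v)
      = 6 * (norm (transpose A *v (B *v v)))\<^sup>2 - 6 * (norm (A *v (B *v v)))\<^sup>2" for v
  proof -
    have "H ** F ** matrix_inv H ** transpose F ** H = transpose (transpose A ** B) ** (transpose A ** B)"
      unfolding AATB[symmetric] by (simp add: matrix_transpose_mul matrix_mul_assoc)
    moreover have "transpose F ** H ** F = transpose (A ** B) ** (A ** B)"
      unfolding BB[symmetric] AB by (simp add: matrix_transpose_mul matrix_mul_assoc)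
    ultimately show ?thesis
      by (simp add: flow_tensor_def matrix_vector_mult_diff_rdistrib scaleR_matrix_vector_assoc[symmetric]
          inner_diff_right quad matrix_vector_mul_assoc)
  qed
  show thesis using that[OF BC CB BB 1 2 3 4] .
qed

text \<open>In the frame, \<open>flow_scalar F H\<close> is at least twice the squared norm of \<open>A\<close>, which in turn bounds
  the forms of \<open>A A\<^sup>T\<close> and \<open>A\<^sup>T A\<close>.\<close>

lemma flow_tensor_bound:
  fixes F H :: "real^'m^'m"
  assumes H: "H \<in> Sym_plus"
  shows "\<bar>v \<bullet> (flow_tensor F H *v v)\<bar> \<le> 3 * flow_scalar F H * (v \<bullet> (H *v v))"
    and "flow_scalar F H \<ge> 0"
proof -
  obtain A B C :: "real^'m^'m" where
    q: "\<And>v. v \<bullet> (H *v v) = (norm (B *v v))\<^sup>2"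
    and S: "flow_scalar F H = 3 * (norm A)\<^sup>2 + trace (A ** A)"
    and T: "\<And>v. v \<bullet> (flow_tensor F H *v v)
      = 6 * (norm (transpose A *v (B *v v)))\<^sup>2 - 6 * (norm (A *v (B *v v)))\<^sup>2"
    using H by (rule flow_in_frame[where F = F]) blast
  have SA: "2 * (norm A)\<^sup>2 \<le> flow_scalar F H"
    using trace_mult_self_ge[of A] by (simp add: S)
  then show "flow_scalar F H \<ge> 0" by (meson order_trans zero_le_power2 mult_nonneg_nonneg zero_le_numeral)
  let ?w = "B *v v"
  have "norm (transpose A *v ?w) \<le> norm A * norm ?w"
    using norm_matrix_vector_mult_le[of "transpose A" ?w] by (simp add: norm_transpose)
  then have 1: "(norm (transpose A *v ?w))\<^sup>2 \<le> (norm A)\<^sup>2 * (norm ?w)\<^sup>2"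
    unfolding power_mult_distrib[symmetric] by (rule power_mono) simp
  have 2: "(norm (A *v ?w))\<^sup>2 \<le> (norm A)\<^sup>2 * (norm ?w)\<^sup>2"
    unfolding power_mult_distrib[symmetric] by (rule power_mono[OF norm_matrix_vector_mult_le]) simp
  have "\<bar>v \<bullet> (flow_tensor F H *v v)\<bar> \<le> 6 * ((norm A)\<^sup>2 * (norm ?w)\<^sup>2)"
    unfolding T abs_le_iff
    using 1 2 zero_le_power2[of "norm (A *v ?w)"] zero_le_power2[of "norm (transpose A *v ?w)"] by linarith
  also have "\<dots> = 3 * (2 * (norm A)\<^sup>2) * (norm ?w)\<^sup>2" by simp
  also have "\<dots> \<le> 3 * flow_scalar F H * (norm ?w)\<^sup>2"
    using SA by (intro mult_right_mono mult_left_mono) auto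
  finally show "\<bar>v \<bullet> (flow_tensor F H *v v)\<bar> \<le> 3 * flow_scalar F H * (v \<bullet> (H *v v))"
    by (simp add: q)
qed

text \<open>The eigenvalues of \<open>A\<close> are those of \<open>F\<close>, and the norm of a matrix is at least the modulus of any
  of its eigenvalues. So a nonzero eigenvalue of \<open>F\<close> gives a bound that is independent of \<open>H\<close>.\<close>

lemma flow_scalar_bounded_below:
  fixes F :: "real^'m^'m"
  assumes "\<And>k. ((*v) F ^^ k) v \<noteq> 0"
  shows "\<exists>c>0. \<forall>H\<in>Sym_plus. c \<le> flow_scalar F H"
proof -
  obtain a b :: real and x y :: "real^'m" where ab: "a\<^sup>2 + b\<^sup>2 > 0" and xy: "x \<noteq> 0 \<or> y \<noteq> 0"
    and Fx: "F *v x = a *\<^sub>R x - b *\<^sub>R y" and Fy: "F *v y = b *\<^sub>R x + a *\<^sub>R y"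
    using assms by (rule nonzero_complex_eigenvalue)
  have "2 * (a\<^sup>2 + b\<^sup>2) \<le> flow_scalar F H" if H: "H \<in> Sym_plus" for H
  proof -
    obtain A B C :: "real^'m^'m" where
      CB: "C ** B = mat 1"
      and AB: "\<And>v. B *v (F *v v) = A *v (B *v v)"
      and S: "flow_scalar F H = 3 * (norm A)\<^sup>2 + trace (A ** A)"
      using H by (rule flow_in_frame[where F = F]) blast
    define X Y where "X = B *v x" and "Y = B *v y"
    have B0: "v = 0" if "B *v v = 0" for v
      using arg_cong[OF that, of "(*v) C"] by (simp add: matrix_vector_mul_assoc CB)
    have AX: "A *v X = a *\<^sub>R X - b *\<^sub>R Y" and AY: "A *v Y = b *\<^sub>R X + a *\<^sub>R Y"
      using AB[of x] AB[of y]
      by (simp_all add: Fx Fy X_def Y_def matrix_vector_mult_diff_distrib matrix_vector_right_distrib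
          matrix_vector_mult_scaleR)
    have pos: "(norm X)\<^sup>2 + (norm Y)\<^sup>2 > 0"
      using xy B0 by (auto simp: X_def Y_def sum_power2_gt_zero_iff)
    have "(a\<^sup>2 + b\<^sup>2) * ((norm X)\<^sup>2 + (norm Y)\<^sup>2) = (norm (A *v X))\<^sup>2 + (norm (A *v Y))\<^sup>2"
      unfolding AX AY power2_norm_eq_inner
      by (simp add: inner_diff_left inner_diff_right inner_add_left inner_add_right inner_commute[of Y X]
          power2_eq_square algebra_simps)
    also have "\<dots> \<le> (norm A * norm X)\<^sup>2 + (norm A * norm Y)\<^sup>2"
      by (intro add_mono power_mono norm_matrix_vector_mult_le) auto
    also have "\<dots> = (norm A)\<^sup>2 * ((norm X)\<^sup>2 + (norm Y)\<^sup>2)"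
      by (simp add: power_mult_distrib algebra_simps)
    finally have "a\<^sup>2 + b\<^sup>2 \<le> (norm A)\<^sup>2" using pos by (simp only: mult_le_cancel_right_pos)
    then show ?thesis using trace_mult_self_ge[of A] by (simp add: S)
  qed
  then show ?thesis using ab by (intro exI[of _ "2 * (a\<^sup>2 + b\<^sup>2)"]) auto
qed

lemma Sym_plus_inverse:
  fixes H :: "real^'m^'m"
  assumes "H \<in> Sym_plus"
  shows "invertible H" "transpose (matrix_inv H) = matrix_inv H" "det H > 0"
proof -
  obtain B C :: "real^'m^'m" where B: "transpose B ** B = H" "B ** C = mat 1" "C ** B = mat 1" "matrix_inv H = C ** transpose C"
    using assms by (rule Sym_plus_frame)
  show "transpose (matrix_inv H) = matrix_inv H" by (simp add: B(4) matrix_transpose_mul)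
  have "det B * det C = 1" using arg_cong[OF B(2), of det] by (simp add: det_mul)
  then have "det B \<noteq> 0" by auto
  then show "det H > 0" by (simp add: B(1)[symmetric] det_mul power2_eq_square[symmetric])
  then show "invertible H" by (simp add: invertible_det_nz)
qed

text \<open>In the frame this is the trace of a multiple of the commutator of \<open>A\<close> and \<open>A\<^sup>T\<close>. It means that
  the flow tensor does not change the volume of \<open>H\<close>.\<close>

lemma trace_inv_flow_tensor:
  fixes F H :: "real^'m^'m"
  assumes "H \<in> Sym_plus"
  shows "trace (matrix_inv H ** flow_tensor F H) = 0"
proof -
  let ?P = "matrix_inv H"
  have PH: "?P ** H = mat 1" using matrix_inv_mult[OF Sym_plus_inverse(1)[OF assms]] by simp
  have "?P ** (H ** F ** ?P ** transpose F ** H) = (F ** ?P) ** (transpose F ** H)"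
    by (simp add: matrix_mul_assoc PH)
  then have "trace (?P ** (H ** F ** ?P ** transpose F ** H)) = trace ((F ** ?P) ** (transpose F ** H))"
    by (rule arg_cong)
  also have "\<dots> = trace ((transpose F ** H) ** (F ** ?P))" by (rule trace_mul_sym)
  also have "(transpose F ** H) ** (F ** ?P) = (transpose F ** H ** F) ** ?P" by (simp add: matrix_mul_assoc)
  also have "trace \<dots> = trace (?P ** (transpose F ** H ** F))" by (rule trace_mul_sym)
  finally have eq: "trace (?P ** (H ** F ** ?P ** transpose F ** H)) = trace (?P ** (transpose F ** H ** F))" .
  note bb = bounded_bilinear_matrix_mult[where 'm = 'm and 'n = 'm and 'k = 'm]
  have tr: "trace (c *\<^sub>R M) = c * trace M" for c and M :: "real^'m^'m"
    by (simp add: trace_def sum_distrib_left)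
  show ?thesis
    unfolding flow_tensor_def bounded_bilinear.diff_right[OF bb] bounded_bilinear.scaleR_right[OF bb]
    by (simp add: trace_sub tr eq)
qed

lemma Sym_plus_pinched:
  fixes H :: "real^'m^'m"
  assumes H: "H \<in> Sym_plus"
  shows "\<exists>e>0. \<exists>E. \<forall>v. e * (v \<bullet> v) \<le> v \<bullet> (H *v v) \<and> v \<bullet> (H *v v) \<le> E * (v \<bullet> v)"
proof -
  obtain B C :: "real^'m^'m" where B: "transpose B ** B = H" "B ** C = mat 1" "C ** B = mat 1" "matrix_inv H = C ** transpose C"
    using H by (rule Sym_plus_frame)
  have q: "v \<bullet> (H *v v) = (norm (B *v v))\<^sup>2" for v
    unfolding B(1)[symmetric] by (rule gram_quadratic_form)
  have up: "v \<bullet> (H *v v) \<le> (norm B)\<^sup>2 * (v \<bullet> v)" for v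
    unfolding q power2_norm_eq_inner[symmetric, of v] power_mult_distrib[symmetric]
    by (rule power_mono[OF norm_matrix_vector_mult_le]) simp
  have low: "v \<bullet> v \<le> ((norm C)\<^sup>2 + 1) * (v \<bullet> (H *v v))" for v
  proof -
    have "norm v \<le> norm C * norm (B *v v)"
      using norm_matrix_vector_mult_le[of C "B *v v"] by (simp add: matrix_vector_mul_assoc B(3))
    then have "(norm v)\<^sup>2 \<le> (norm C)\<^sup>2 * (norm (B *v v))\<^sup>2"
      unfolding power_mult_distrib[symmetric] by (rule power_mono) simp
    also have "\<dots> \<le> ((norm C)\<^sup>2 + 1) * (norm (B *v v))\<^sup>2" by (intro mult_right_mono) auto
    finally show ?thesis by (simp add: q power2_norm_eq_inner)
  qed
  have "(1 / ((norm C)\<^sup>2 + 1)) * (v \<bullet> v) \<le> v \<bullet> (H *v v)" for v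
  proof -
    have "(norm C)\<^sup>2 + 1 > 0" by (simp add: add_nonneg_pos)
    then show ?thesis using low[of v] by (simp add: divide_le_eq mult.commute)
  qed
  then show ?thesis
    using up by (intro exI[of _ "1 / ((norm C)\<^sup>2 + 1)"] exI[of _ "(norm B)\<^sup>2"] conjI) (auto simp: add_nonneg_pos)
qed

text \<open>Polarisation bounds the entries of a semidefinite matrix by its largest diagonal entry.\<close>

lemma compact_pinched:
  fixes e E l u :: real
  assumes "e \<ge> 0"
  shows "compact {p :: (real^'m^'m) \<times> real. transpose (fst p) = fst p \<and>
    (\<forall>v. e * (v \<bullet> v) \<le> v \<bullet> (fst p *v v) \<and> v \<bullet> (fst p *v v) \<le> E * (v \<bullet> v)) \<and> l \<le> snd p \<and> snd p \<le> u}"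
    (is "compact ?K")
proof -
  have cont: "continuous_on UNIV (\<lambda>p :: (real^'m^'m) \<times> real. v \<bullet> (fst p *v v))" for v
    unfolding matrix_vector_mult_def inner_vec_def by (simp, intro continuous_intros)
  have K: "?K = {p. \<forall>i j. fst p $ j $ i = fst p $ i $ j} \<inter>
     (\<Inter>v. {p. e * (v \<bullet> v) \<le> v \<bullet> (fst p *v v)} \<inter> {p. v \<bullet> (fst p *v v) \<le> E * (v \<bullet> v)}) \<inter>
     {p. l \<le> snd p} \<inter> {p. snd p \<le> u}"
    by (auto simp: vec_eq_iff transpose_def)
  have "closed ?K" unfolding K
    by (intro closed_Int closed_INT closed_Collect_all closed_Collect_eq closed_Collect_le ballI cont
        continuous_intros)
  moreover have "bounded ?K"
  proof (rule boundedI)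
    fix p assume p: "p \<in> ?K"
    let ?X = "fst p"
    have sym: "transpose ?X = ?X" and up: "\<And>v. v \<bullet> (?X *v v) \<le> E * (v \<bullet> v)"
      and el: "\<And>v. e * (v \<bullet> v) \<le> v \<bullet> (?X *v v)" using p by blast+
    have low: "0 \<le> v \<bullet> (?X *v v)" for v
      using el[of v] assms by (meson inner_ge_zero mult_nonneg_nonneg order_trans)
    have diag: "?X $ i $ i \<le> E" for i
      using up[of "axis i 1"] by (simp add: quadratic_form_axis(2) inner_axis_axis)
    have entry: "\<bar>?X $ i $ j\<bar> \<le> E" for i j
    proof -
      have "0 \<le> ?X $ j $ j + 2 * c * ?X $ i $ j + c\<^sup>2 * ?X $ i $ i" for c
        using low[of "axis j 1 + c *\<^sub>R axis i 1"]
        by (simp only: quadratic_form_plus[OF sym] quadratic_form_axis(2))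
      from this[of 1] this[of "-1"] show ?thesis using diag[of i] diag[of j] by simp
    qed
    have E: "E \<ge> 0" using entry[of undefined undefined] by linarith
    have "?X \<bullet> ?X \<le> (\<Sum>i\<in>(UNIV :: 'm set). \<Sum>j\<in>(UNIV :: 'm set). E * E)"
      unfolding inner_vec_def
    proof (intro sum_mono)
      show "?X $ i $ j \<bullet> ?X $ i $ j \<le> E * E" for i j
        using mult_mono[OF entry[of i j] entry[of i j]] E by (simp add: abs_mult_self_eq)
    qed
    also have "\<dots> = (real CARD('m) * E)\<^sup>2" by (simp add: power2_eq_square)
    finally have "norm ?X \<le> real CARD('m) * E"
      unfolding power2_norm_eq_inner[symmetric] by (rule power2_le_imp_le) (use E in simp)
    moreover have "norm (snd p) \<le> \<bar>l\<bar> + \<bar>u\<bar>" using p by (auto simp: abs_if)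
    ultimately show "norm p \<le> real CARD('m) * E + (\<bar>l\<bar> + \<bar>u\<bar>)"
      using norm_fst_le norm_Pair_le[of "fst p" "snd p"] by fastforce
  qed
  ultimately show ?thesis by (simp add: compact_eq_bounded_closed)
qed

lemma lipschitz_near_scaled_flow:
  fixes F X :: "real^'m^'m"
  assumes "invertible X" "y > 0"
  shows "lipschitz_near (scaled_flow \<alpha> \<beta> F) (X, y)"
proof -
  let ?p = "(X, y)"
  note mm = lipschitz_near_bilinear[OF bounded_bilinear_matrix_mult]
    and sc = lipschitz_near_bilinear[OF bounded_bilinear_scaleR]
    and mu = lipschitz_near_bilinear[OF bounded_bilinear_mult]
  have f: "lipschitz_near (\<lambda>p :: (real^'m^'m) \<times> real. fst p) ?p"
    and s: "lipschitz_near (\<lambda>p :: (real^'m^'m) \<times> real. snd p) ?p"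
    by (rule lipschitz_near_bounded_linear, rule bounded_linear_fst bounded_linear_snd)+
  have i: "lipschitz_near (\<lambda>p :: (real^'m^'m) \<times> real. matrix_inv (fst p)) ?p"
    by (rule lipschitz_near_compose[OF f]) (simp add: lipschitz_near_matrix_inv assms)
  have r: "lipschitz_near (\<lambda>p :: (real^'m^'m) \<times> real. 1 / snd p) ?p"
    by (rule lipschitz_near_compose[OF s, of "\<lambda>h. 1 / h"]) (simp add: lipschitz_near_inverse assms)
  have "linear (trace :: real^'m^'m \<Rightarrow> real)"
    by (intro linearI) (simp_all add: trace_def sum.distrib sum_distrib_left)
  then have tr: "lipschitz_near (trace :: real^'m^'m \<Rightarrow> real) Z" for Z
    by (intro lipschitz_near_bounded_linear) (simp add: linear_conv_bounded_linear)
  have S: "lipschitz_near (\<lambda>p :: (real^'m^'m) \<times> real. flow_scalar F (fst p)) ?p"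
    unfolding flow_scalar_def
    by (intro lipschitz_near_add mu lipschitz_near_const lipschitz_near_compose[OF _ tr] mm f i)
  have T: "lipschitz_near (\<lambda>p :: (real^'m^'m) \<times> real. flow_tensor F (fst p)) ?p"
    unfolding flow_tensor_def
    by (intro lipschitz_near_diff sc lipschitz_near_const mm f i)
  have eq: "scaled_flow \<alpha> \<beta> F = (\<lambda>p. (((- 1 / 64) * (1 / snd p)) *\<^sub>R
      ((\<alpha> * flow_scalar F (fst p)) *\<^sub>R fst p + flow_tensor F (fst p)), \<beta> * flow_scalar F (fst p)))"
    by (simp add: scaled_flow_def fun_eq_iff split: prod.split)
  show ?thesis unfolding eq
    by (intro lipschitz_near_Pair lipschitz_near_add mu sc lipschitz_near_const S T r f)
qed

section \<open>Solutions of the flow\<close>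

definition flow_domain :: "((real^'m^'m) \<times> real) set" where
  "flow_domain = Sym_plus \<times> {0<..}"

lemma symmetric_near_Sym_plus:
  fixes X1 X :: "real^'m^'m"
  assumes e: "\<And>v. e * (v \<bullet> v) \<le> v \<bullet> (X1 *v v)" and X: "transpose X = X" "norm (X - X1) < e"
  shows "X \<in> Sym_plus"
proof -
  have "v \<bullet> (X *v v) > 0" if "v \<noteq> 0" for v
  proof -
    have "\<bar>v \<bullet> ((X - X1) *v v)\<bar> \<le> norm v * norm ((X - X1) *v v)" by (rule Cauchy_Schwarz_ineq2)
    also have "\<dots> \<le> norm v * (norm (X - X1) * norm v)"
      by (intro mult_left_mono norm_matrix_vector_mult_le) simp
    also have "\<dots> = norm (X - X1) * (v \<bullet> v)" by (simp add: power2_norm_eq_inner[symmetric] power2_eq_square)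
    also have "\<dots> < e * (v \<bullet> v)" using X(2) that by (intro mult_strict_right_mono) auto
    finally have "\<bar>v \<bullet> ((X - X1) *v v)\<bar> < v \<bullet> (X1 *v v)" using e[of v] by linarith
    moreover have "v \<bullet> (X *v v) = v \<bullet> (X1 *v v) + v \<bullet> ((X - X1) *v v)"
      by (simp add: matrix_vector_mult_diff_rdistrib inner_diff_right)
    ultimately show ?thesis by linarith
  qed
  with X(1) show ?thesis by (simp add: Sym_plus_def)
qed

lemma transpose_scaled_flow:
  assumes "X \<in> Sym_plus"
  shows "transpose (fst (scaled_flow \<alpha> \<beta> F (X, y))) = fst (scaled_flow \<alpha> \<beta> F (X, y))"
proof -
  have X: "transpose X = X" using assms by (simp add: Sym_plus_def)
  have add: "transpose (A + B) = transpose A + transpose B"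
    and diff: "transpose (A - B) = transpose A - transpose B"
    and minus: "transpose (- A) = - transpose A"
    and scale: "transpose (c *\<^sub>R A) = c *\<^sub>R transpose A" for A B :: "real^'m^'m" and c
    by (simp_all add: transpose_def vec_eq_iff)
  show ?thesis
    by (simp add: scaled_flow_def flow_tensor_def add diff minus scale X matrix_transpose_mul
        Sym_plus_inverse(2)[OF assms] matrix_mul_assoc)
qed

text \<open>The Picard theorem works in the space of all matrices, and its solution has to be shown symmetric.
  Therefore it is applied to the field precomposed with the symmetrisation of matrices. The factor
  \<open>\<sigma>\<close> allows time to be reversed.\<close>

lemma scaled_flow_local_solution:
  fixes F :: "real^'m^'m"
  assumes p: "p \<in> flow_domain"
  shows "\<exists>\<delta>>0. \<exists>y. y 0 = p \<and> (\<forall>t\<in>{0..\<delta>}. y t \<in> flow_domain \<and>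
    (y has_vector_derivative \<sigma> *\<^sub>R scaled_flow \<alpha> \<beta> F (y t)) (at t within {0..\<delta>}))"
proof -
  obtain X1 y1 where p_eq: "p = (X1, y1)" and X1: "X1 \<in> Sym_plus" and y1: "y1 > 0"
    using p by (auto simp: flow_domain_def)
  have X1s: "transpose X1 = X1" using X1 by (simp add: Sym_plus_def)
  obtain e where e: "e > 0" "\<And>v. e * (v \<bullet> v) \<le> v \<bullet> (X1 *v v)" using Sym_plus_pinched[OF X1] by blast
  define sy :: "(real^'m^'m) \<times> real \<Rightarrow> (real^'m^'m) \<times> real"
    where "sy = (\<lambda>q. ((1 / 2) *\<^sub>R (fst q + transpose (fst q)), snd q))"
  have tr_lin: "linear (transpose :: real^'m^'m \<Rightarrow> real^'m^'m)"
    by (intro linearI) (simp_all add: transpose_def vec_eq_iff)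
  then have tr_bl: "bounded_linear (transpose :: real^'m^'m \<Rightarrow> real^'m^'m)"
    by (simp add: linear_conv_bounded_linear)
  note tr_fst = bounded_linear_compose[OF tr_bl bounded_linear_fst]
  have sy_bl: "bounded_linear sy"
    unfolding sy_def
    by (intro bounded_linear_Pair bounded_linear_snd bounded_linear_compose[OF bounded_linear_scaleR_right]
        bounded_linear_add bounded_linear_fst tr_fst)
  have sy_p: "sy p = p" by (simp add: sy_def p_eq X1s scaleR_2[symmetric])
  define f where "f = (\<lambda>q. \<sigma> *\<^sub>R scaled_flow \<alpha> \<beta> F (sy q))"
  have "lipschitz_near (\<lambda>q. scaled_flow \<alpha> \<beta> F (sy q)) p"
  proof (rule lipschitz_near_compose[OF lipschitz_near_bounded_linear[OF sy_bl]])
    show "lipschitz_near (scaled_flow \<alpha> \<beta> F) (sy p)"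
      unfolding sy_p unfolding p_eq by (rule lipschitz_near_scaled_flow[OF Sym_plus_inverse(1)[OF X1] y1])
  qed
  then have "lipschitz_near f p"
    unfolding f_def by (rule lipschitz_near_bilinear[OF bounded_bilinear_scaleR lipschitz_near_const])
  then obtain r0 L where r0: "r0 > 0" and L0: "L-lipschitz_on (cball p r0) f" by (rule lipschitz_nearE)
  define r where "r = min r0 (min e y1 / 2)"
  have r: "r > 0" "r < e" "r < y1" using r0 e y1 by (auto simp: r_def min_def)
  have "L-lipschitz_on (cball p r) f"
    using L0 by (rule lipschitz_on_subset) (auto simp: r_def)
  then obtain \<delta> y where \<delta>: "\<delta> > 0" and y0: "y 0 = p" and y: "\<And>t. t \<in> {0..\<delta>} \<Longrightarrow> y t \<in> cball p r"
      "\<And>t. t \<in> {0..\<delta>} \<Longrightarrow> (y has_vector_derivative f (y t)) (at t within {0..\<delta>})"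
    using picard_lindelof_right[OF _ r(1), of L p f] by blast
  have sy_in: "fst (sy q) \<in> Sym_plus" and snd_pos: "snd q > 0" if q: "q \<in> cball p r" for q
  proof -
    have f: "norm (fst q - X1) \<le> r" and s: "\<bar>snd q - y1\<bar> \<le> r"
    proof -
      have "q - p = (fst q - X1, snd q - y1)" by (simp add: p_eq prod_eq_iff)
      moreover have "norm (q - p) \<le> r" using q by (simp add: dist_norm norm_minus_commute)
      ultimately have "norm (fst q - X1, snd q - y1) \<le> r" by simp
      then show "norm (fst q - X1) \<le> r" "\<bar>snd q - y1\<bar> \<le> r"
        using norm_fst_le[of "fst q - X1" "snd q - y1"] norm_snd_le[of "snd q - y1" "fst q - X1"]
        by simp_all
    qed
    show "snd q > 0" using s r by linarith
    have "fst (sy q) - X1 = (1 / 2) *\<^sub>R ((fst q - X1) + transpose (fst q - X1))"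
    proof -
      have T: "transpose (fst q - X1) = transpose (fst q) - X1"
        using linear_diff[OF tr_lin] by (simp add: X1s)
      show ?thesis unfolding T sy_def by (simp add: vec_eq_iff field_simps)
    qed
    then have "norm (fst (sy q) - X1) \<le> (1 / 2) * (norm (fst q - X1) + norm (fst q - X1))"
      using norm_triangle_ineq[of "fst q - X1" "transpose (fst q - X1)"] by (simp add: norm_transpose)
    then have "norm (fst (sy q) - X1) < e" using f r by simp
    moreover have "transpose (fst (sy q)) = fst (sy q)"
      by (simp add: sy_def transpose_def vec_eq_iff add.commute)
    ultimately show "fst (sy q) \<in> Sym_plus" using symmetric_near_Sym_plus[OF e(2)] by blast
  qed
  \<comment> \<open>The symmetrised field takes symmetric values, so the skew part of the solution is constant.\<close>
  define sk :: "(real^'m^'m) \<times> real \<Rightarrow> real^'m^'m" where "sk = (\<lambda>q. fst q - transpose (fst q))"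
  have sk_bl: "bounded_linear sk"
    unfolding sk_def by (intro bounded_linear_sub bounded_linear_fst tr_fst)
  have sk_f: "sk (f q) = 0" if "q \<in> cball p r" for q
  proof -
    have "transpose (fst (scaled_flow \<alpha> \<beta> F (sy q))) = fst (scaled_flow \<alpha> \<beta> F (sy q))"
      using transpose_scaled_flow[OF sy_in[OF that], of \<alpha> \<beta> F "snd (sy q)"] by simp
    then show ?thesis by (simp add: sk_def f_def linear_cmul[OF tr_lin])
  qed
  have "\<exists>c. \<forall>t\<in>{0..\<delta>}. sk (y t) = c"
  proof (rule has_derivative_zero_constant)
    show "((\<lambda>t. sk (y t)) has_derivative (\<lambda>h. 0)) (at t within {0..\<delta>})" if "t \<in> {0..\<delta>}" for t
      using bounded_linear.has_vector_derivative[OF sk_bl y(2)[OF that]] sk_f[OF y(1)[OF that]]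
      by (simp add: has_vector_derivative_def)
  qed simp
  moreover have "sk (y 0) = 0" by (simp add: sk_def y0 p_eq X1s)
  ultimately have sk0: "sk (y t) = 0" if "t \<in> {0..\<delta>}" for t using that \<delta> by force
  have sy_y: "sy (y t) = y t" if "t \<in> {0..\<delta>}" for t
    using sk0[OF that] by (simp add: sk_def sy_def prod_eq_iff scaleR_2[symmetric])
  have "y t \<in> flow_domain" if t: "t \<in> {0..\<delta>}" for t
    using sy_in[OF y(1)[OF t]] snd_pos[OF y(1)[OF t]] sy_y[OF t]
    by (simp add: flow_domain_def mem_Times_iff)
  moreover have "(y has_vector_derivative \<sigma> *\<^sub>R scaled_flow \<alpha> \<beta> F (y t)) (at t within {0..\<delta>})"
    if t: "t \<in> {0..\<delta>}" for t
    using y(2)[OF t] by (simp add: f_def sy_y[OF t])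
  ultimately show ?thesis using \<delta> y0 by (intro exI[of _ \<delta>] conjI exI[of _ y]) auto
qed

lemma continuous_on_scaled_flow:
  fixes F :: "real^'m^'m"
  shows "continuous_on flow_domain (scaled_flow \<alpha> \<beta> F)"
proof (intro continuous_at_imp_continuous_on ballI)
  fix p :: "(real^'m^'m) \<times> real" assume "p \<in> flow_domain"
  then show "isCont (scaled_flow \<alpha> \<beta> F) p"
    by (cases p) (auto simp: flow_domain_def
        intro: lipschitz_near_imp_isCont lipschitz_near_scaled_flow Sym_plus_inverse)
qed

locale scaled_flow_solution =
  fixes \<alpha> \<beta> :: real and F :: "real^'m^'m" and a b :: ereal
    and H :: "real \<Rightarrow> real^'m^'m" and h :: "real \<Rightarrow> real"
  assumes \<alpha>: "\<alpha> > 0" and \<beta>: "\<beta> > 0" and a: "a < 0" and b: "0 < b"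
    and solution: "\<And>t. a < ereal t \<Longrightarrow> ereal t < b \<Longrightarrow> H t \<in> Sym_plus \<and> 0 < h t \<and>
      ((\<lambda>s. (H s, h s)) has_vector_derivative scaled_flow \<alpha> \<beta> F (H t, h t)) (at t)"
begin

definition "I = {t. a < ereal t \<and> ereal t < b}"

lemma zero_in_I: "0 \<in> I"
  using a b by (simp add: I_def zero_ereal_def)

lemma I_between: "s \<in> I \<Longrightarrow> t \<in> I \<Longrightarrow> s \<le> x \<Longrightarrow> x \<le> t \<Longrightarrow> x \<in> I"
  unfolding I_def by (auto intro: less_le_trans le_less_trans simp flip: ereal_less_eq(3))

lemma pos: "t \<in> I \<Longrightarrow> H t \<in> Sym_plus" "t \<in> I \<Longrightarrow> h t > 0"
  using solution by (auto simp: I_def)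

lemma h_deriv: "t \<in> I \<Longrightarrow> (h has_real_derivative \<beta> * flow_scalar F (H t)) (at t)"
  using bounded_linear.has_vector_derivative[OF bounded_linear_snd, of "\<lambda>s. (H s, h s)"] solution[of t]
  by (auto simp: I_def scaled_flow_def has_real_derivative_iff_has_vector_derivative)

lemma H_deriv: "t \<in> I \<Longrightarrow> (H has_vector_derivative
    (- (1 / (64 * h t)) *\<^sub>R ((\<alpha> * flow_scalar F (H t)) *\<^sub>R H t + flow_tensor F (H t)))) (at t)"
  using bounded_linear.has_vector_derivative[OF bounded_linear_fst, of "\<lambda>s. (H s, h s)"] solution[of t]
  by (auto simp: I_def scaled_flow_def)

lemma h_mono:
  assumes "s \<in> I" "t \<in> I" "s \<le> t"
  shows "h s \<le> h t"
proof (rule DERIV_nonneg_imp_nondecreasing[OF assms(3)])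
  show "\<exists>y. (h has_real_derivative y) (at x) \<and> 0 \<le> y" if "s \<le> x" "x \<le> t" for x
    using h_deriv[OF I_between[OF assms(1,2) that]] flow_tensor_bound(2)[OF pos(1)[OF I_between[OF assms(1,2) that]]] \<beta>
    by (meson less_imp_le mult_nonneg_nonneg)
qed

text \<open>The exponent in the comparison of \<open>H\<close> with powers of \<open>h\<close>.\<close>

definition "\<gamma> = (\<alpha> + 3) / (64 * \<beta>)"

text \<open>The logarithmic derivative of \<open>v \<bullet> (H *v v)\<close> is in absolute value at most a constant times
  \<open>flow_scalar F H / h\<close>, and the latter is, up to a factor, the logarithmic derivative of \<open>h\<close>. So
  control of \<open>h\<close> alone controls \<open>H\<close>.\<close>

lemma ln_quadratic_form_variation:
  assumes st: "s \<in> I" "t \<in> I" "s \<le> t" and v: "v \<noteq> 0"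
  shows "\<bar>ln (v \<bullet> (H t *v v)) - ln (v \<bullet> (H s *v v))\<bar> \<le> \<gamma> * (ln (h t) - ln (h s))"
proof -
  define p where "p = (\<lambda>t. v \<bullet> (H t *v v))"
  define p' where "p' = (\<lambda>t. - (1 / (64 * h t)) * (\<alpha> * flow_scalar F (H t) * p t + v \<bullet> (flow_tensor F (H t) *v v)))"
  have p_pos: "p t > 0" if "t \<in> I" for t using pos(1)[OF that] v by (simp add: p_def Sym_plus_def)
  have "linear (\<lambda>X :: real^'m^'m. v \<bullet> (X *v v))"
    by (intro linearI) (simp_all add: matrix_vector_mult_add_rdistrib inner_add_right scaleR_matrix_vector_assoc[symmetric])
  then have bl: "bounded_linear (\<lambda>X :: real^'m^'m. v \<bullet> (X *v v))" by (simp add: linear_conv_bounded_linear)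
  have p_deriv: "(p has_real_derivative p' t) (at t)" if "t \<in> I" for t
  proof -
    have "(p has_vector_derivative v \<bullet> ((- (1 / (64 * h t)) *\<^sub>R
        ((\<alpha> * flow_scalar F (H t)) *\<^sub>R H t + flow_tensor F (H t))) *v v)) (at t)"
      unfolding p_def by (rule bounded_linear.has_vector_derivative[OF bl H_deriv[OF that]])
    also have "v \<bullet> ((- (1 / (64 * h t)) *\<^sub>R
        ((\<alpha> * flow_scalar F (H t)) *\<^sub>R H t + flow_tensor F (H t))) *v v) = p' t"
      unfolding scaleR_matrix_vector_assoc[symmetric] matrix_vector_mult_add_rdistrib
      by (simp add: p'_def p_def inner_add_right)
    finally show ?thesis by (simp add: has_real_derivative_iff_has_vector_derivative)
  qed
  have bound: "\<bar>p' t / p t\<bar> \<le> \<gamma> * (\<beta> * flow_scalar F (H t) / h t)" if t: "t \<in> I" for t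
  proof -
    let ?S = "flow_scalar F (H t)"
    have S: "?S \<ge> 0" using flow_tensor_bound(2)[OF pos(1)[OF t]] .
    have "\<bar>\<alpha> * ?S * p t + v \<bullet> (flow_tensor F (H t) *v v)\<bar> \<le> \<alpha> * ?S * p t + 3 * ?S * p t"
    proof -
      have "\<bar>v \<bullet> (flow_tensor F (H t) *v v)\<bar> \<le> 3 * ?S * p t"
        using flow_tensor_bound(1)[OF pos(1)[OF t]] by (simp add: p_def)
      moreover have "0 \<le> \<alpha> * ?S * p t" using \<alpha> S p_pos[OF t] by simp
      ultimately show ?thesis by linarith
    qed
    then have "\<bar>p' t\<bar> \<le> 1 / (64 * h t) * (\<alpha> * ?S * p t + 3 * ?S * p t)"
      using pos(2)[OF t] unfolding p'_def by (simp add: abs_mult divide_right_mono)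
    also have "\<dots> = \<gamma> * (\<beta> * ?S / h t) * p t" using \<beta> pos(2)[OF t] by (simp add: \<gamma>_def field_simps)
    finally show ?thesis using p_pos[OF t] by (simp add: divide_le_eq)
  qed
  have lnp: "((\<lambda>t. ln (p t)) has_real_derivative p' t / p t) (at t)" if "t \<in> I" for t
    using DERIV_chain2[OF DERIV_ln_divide[OF p_pos[OF that]] p_deriv[OF that]] by simp
  have lnh: "((\<lambda>t. ln (h t)) has_real_derivative \<beta> * flow_scalar F (H t) / h t) (at t)" if "t \<in> I" for t
    using DERIV_chain2[OF DERIV_ln_divide[OF pos(2)[OF that]] h_deriv[OF that]] by simp
  have "\<gamma> * ln (h s) - ln (p s) \<le> \<gamma> * ln (h t) - ln (p t)"
  proof (rule DERIV_nonneg_imp_nondecreasing[OF st(3)])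
    fix x assume "s \<le> x" "x \<le> t"
    then have x: "x \<in> I" using I_between st by blast
    have "((\<lambda>t. \<gamma> * ln (h t) - ln (p t)) has_real_derivative
        \<gamma> * (\<beta> * flow_scalar F (H x) / h x) - p' x / p x) (at x)"
      by (intro DERIV_diff DERIV_cmult lnp lnh x)
    moreover have "0 \<le> \<gamma> * (\<beta> * flow_scalar F (H x) / h x) - p' x / p x"
      using bound[OF x] by linarith
    ultimately show "\<exists>y. ((\<lambda>t. \<gamma> * ln (h t) - ln (p t)) has_real_derivative y) (at x) \<and> 0 \<le> y" by blast
  qed
  moreover have "\<gamma> * ln (h s) + ln (p s) \<le> \<gamma> * ln (h t) + ln (p t)"
  proof (rule DERIV_nonneg_imp_nondecreasing[OF st(3)])
    fix x assume "s \<le> x" "x \<le> t"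
    then have x: "x \<in> I" using I_between st by blast
    have "((\<lambda>t. \<gamma> * ln (h t) + ln (p t)) has_real_derivative
        \<gamma> * (\<beta> * flow_scalar F (H x) / h x) + p' x / p x) (at x)"
      by (intro DERIV_add DERIV_cmult lnp lnh x)
    moreover have "0 \<le> \<gamma> * (\<beta> * flow_scalar F (H x) / h x) + p' x / p x"
      using bound[OF x] by linarith
    ultimately show "\<exists>y. ((\<lambda>t. \<gamma> * ln (h t) + ln (p t)) has_real_derivative y) (at x) \<and> 0 \<le> y" by blast
  qed
  ultimately have "\<bar>ln (p t) - ln (p s)\<bar> \<le> \<gamma> * (ln (h t) - ln (h s))"
    by (simp add: abs_le_iff algebra_simps)
  then show ?thesis by (simp add: p_def)
qed

text \<open>Compared with the positive definite matrix \<open>H 0\<close>, the form of \<open>H t\<close> changes at most by a factor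
  \<open>(u / l) powr \<gamma>\<close> in either direction, and such matrices form a compact set.\<close>

lemma stays_in_compact:
  assumes l: "0 < l" "l \<le> u"
  shows "\<exists>K. compact K \<and> K \<subseteq> flow_domain \<and>
    (\<forall>t\<in>I. l \<le> h t \<and> h t \<le> u \<and> l \<le> h 0 \<and> h 0 \<le> u \<longrightarrow> (H t, h t) \<in> K)"
proof -
  obtain e E where e: "e > 0" and eE: "\<And>v. e * (v \<bullet> v) \<le> v \<bullet> (H 0 *v v)" "\<And>v. v \<bullet> (H 0 *v v) \<le> E * (v \<bullet> v)"
    using Sym_plus_pinched[OF pos(1)[OF zero_in_I]] by blast
  define w where "w = \<gamma> * (ln u - ln l)"
  have \<gamma>: "\<gamma> > 0" using \<alpha> \<beta> by (simp add: \<gamma>_def)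
  define K where "K = {p :: (real^'m^'m) \<times> real. transpose (fst p) = fst p \<and>
    (\<forall>v. (e * exp (- w)) * (v \<bullet> v) \<le> v \<bullet> (fst p *v v) \<and> v \<bullet> (fst p *v v) \<le> (E * exp w) * (v \<bullet> v))
    \<and> l \<le> snd p \<and> snd p \<le> u}"
  have "compact K" unfolding K_def by (rule compact_pinched) (use e in simp)
  moreover have "K \<subseteq> flow_domain"
  proof
    fix p assume p: "p \<in> K"
    have "v \<bullet> (fst p *v v) > 0" if "v \<noteq> 0" for v
    proof -
      have "0 < (e * exp (- w)) * (v \<bullet> v)" using e that by simp
      also have "\<dots> \<le> v \<bullet> (fst p *v v)" using p by (simp add: K_def)
      finally show ?thesis .
    qed
    then show "p \<in> flow_domain"
      using p l by (simp add: K_def flow_domain_def Sym_plus_def mem_Times_iff)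
  qed
  moreover have "(H t, h t) \<in> K" if t: "t \<in> I" and ht: "l \<le> h t" "h t \<le> u" "l \<le> h 0" "h 0 \<le> u" for t
  proof -
    have lnw: "\<gamma> * \<bar>ln (h t) - ln (h 0)\<bar> \<le> w"
    proof -
      have "ln l \<le> ln (h t)" "ln (h t) \<le> ln u" "ln l \<le> ln (h 0)" "ln (h 0) \<le> ln u"
        using ht l pos(2)[OF t] pos(2)[OF zero_in_I] by simp_all
      then have "\<bar>ln (h t) - ln (h 0)\<bar> \<le> ln u - ln l" by linarith
      then show ?thesis unfolding w_def using \<gamma> by (intro mult_left_mono) auto
    qed
    have quad: "(e * exp (- w)) * (v \<bullet> v) \<le> v \<bullet> (H t *v v) \<and> v \<bullet> (H t *v v) \<le> (E * exp w) * (v \<bullet> v)" for v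
    proof (cases "v = 0")
      case False
      define q q0 where "q = v \<bullet> (H t *v v)" and "q0 = v \<bullet> (H 0 *v v)"
      have qp: "q > 0" "q0 > 0"
        using pos(1)[OF t] pos(1)[OF zero_in_I] False by (auto simp: q_def q0_def Sym_plus_def)
      have "\<bar>ln q - ln q0\<bar> \<le> \<gamma> * \<bar>ln (h t) - ln (h 0)\<bar>"
      proof (cases "0 \<le> t")
        case True
        have "\<gamma> * (ln (h t) - ln (h 0)) \<le> \<gamma> * \<bar>ln (h t) - ln (h 0)\<bar>" using \<gamma> by simp
        with ln_quadratic_form_variation[OF zero_in_I t True False] show ?thesis
          unfolding q_def q0_def by linarith
      next
        case neg: False
        have "\<gamma> * (ln (h 0) - ln (h t)) \<le> \<gamma> * \<bar>ln (h t) - ln (h 0)\<bar>" using \<gamma> by simp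
        with ln_quadratic_form_variation[OF t zero_in_I _ False] neg show ?thesis
          unfolding q_def q0_def by linarith
      qed
      with lnw have "\<bar>ln q - ln q0\<bar> \<le> w" by linarith
      then have "ln q0 - w \<le> ln q" "ln q \<le> ln q0 + w" by linarith+
      then have "exp (ln q0 - w) \<le> exp (ln q)" "exp (ln q) \<le> exp (ln q0 + w)" by simp_all
      then have qb: "q0 * exp (- w) \<le> q" "q \<le> q0 * exp w"
        using qp by (simp_all add: exp_add exp_diff exp_minus divide_inverse)
      have "e * (v \<bullet> v) * exp (- w) \<le> q0 * exp (- w)" "q0 * exp w \<le> E * (v \<bullet> v) * exp w"
        using eE[of v] by (auto simp: q0_def intro!: mult_right_mono)
      with qb have "e * (v \<bullet> v) * exp (- w) \<le> q" "q \<le> E * (v \<bullet> v) * exp w" by linarith+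
      then show ?thesis unfolding q_def[symmetric] by (simp add: mult_ac)
    qed simp
    then show ?thesis using pos(1)[OF t] ht by (simp add: K_def Sym_plus_def)
  qed
  ultimately show ?thesis by blast
qed

text \<open>By the Jacobi formula and the vanishing of the trace of the flow tensor, the logarithmic derivative
  of \<open>det H\<close> is \<open>- \<kappa>\<close> times that of \<open>h\<close>, so \<open>det H * h powr \<kappa>\<close> is constant. The logarithmic form
  is the one from which the limits of \<open>det H\<close> are read off.\<close>

lemma det_conserved:
  fixes \<kappa> :: real
  defines "\<kappa> \<equiv> \<alpha> * real CARD('m) / (64 * \<beta>)"
  assumes t: "t \<in> I"
  shows "ln (det (H t)) = ln (det (H 0)) + \<kappa> * ln (h 0) - \<kappa> * ln (h t)"
proof -
  define k where "k = (\<lambda>t. ln (det (H t)) + \<kappa> * ln (h t))"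
  have k_deriv: "(k has_real_derivative 0) (at x)" if x: "x \<in> I" for x
  proof -
    let ?S = "flow_scalar F (H x)"
    note P = Sym_plus_inverse[OF pos(1)[OF x]]
    note bb = bounded_bilinear_matrix_mult[where 'm = 'm and 'n = 'm and 'k = 'm]
    define H' where "H' = - (1 / (64 * h x)) *\<^sub>R ((\<alpha> * ?S) *\<^sub>R H x + flow_tensor F (H x))"
    have tr: "trace (c *\<^sub>R M) = c * trace M" for c and M :: "real^'m^'m"
      by (simp add: trace_def sum_distrib_left)
    have "matrix_inv (H x) ** H x = mat 1" using matrix_inv_mult[OF P(1)] by simp
    then have tr': "trace (matrix_inv (H x) ** H') = - (1 / (64 * h x)) * (\<alpha> * ?S * real CARD('m))"
      unfolding H'_def bounded_bilinear.add_right[OF bb] bounded_bilinear.scaleR_right[OF bb] tr trace_add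
        trace_inv_flow_tensor[OF pos(1)[OF x]]
      by (simp add: trace_I)
    have HH: "(H has_vector_derivative H') (at x)" unfolding H'_def by (rule H_deriv[OF x])
    have "((\<lambda>s. det (H s)) has_real_derivative
        det (H x) * (- (1 / (64 * h x)) * (\<alpha> * ?S * real CARD('m)))) (at x)"
      unfolding tr'[symmetric] by (rule jacobi_formula[where H = H, OF P(1) HH])
    from DERIV_chain2[OF DERIV_ln_divide[OF P(3)] this]
    have "((\<lambda>s. ln (det (H s))) has_real_derivative - (1 / (64 * h x)) * (\<alpha> * ?S * real CARD('m))) (at x)"
      using P(3) by simp
    moreover have "((\<lambda>s. ln (h s)) has_real_derivative \<beta> * ?S / h x) (at x)"
      using DERIV_chain2[OF DERIV_ln_divide[OF pos(2)[OF x]] h_deriv[OF x]] by simp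
    ultimately have "(k has_real_derivative
        - (1 / (64 * h x)) * (\<alpha> * ?S * real CARD('m)) + \<kappa> * (\<beta> * ?S / h x)) (at x)"
      unfolding k_def by (intro DERIV_add DERIV_cmult)
    moreover have "- (1 / (64 * h x)) * (\<alpha> * ?S * real CARD('m)) + \<kappa> * (\<beta> * ?S / h x) = 0"
      using \<beta> pos(2)[OF x] by (simp add: \<kappa>_def field_simps)
    ultimately show ?thesis by simp
  qed
  have const: "k r = k s" if rs: "r \<in> I" "s \<in> I" "r \<le> s" for r s
  proof (rule antisym)
    show "k r \<le> k s"
      by (rule DERIV_nonneg_imp_nondecreasing[OF rs(3)]) (use k_deriv I_between rs in blast)
    show "k s \<le> k r"
      by (rule DERIV_nonpos_imp_nonincreasing[OF rs(3)]) (use k_deriv I_between rs in blast)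
  qed
  have "k t = k 0"
  proof (cases "0 \<le> t")
    case True
    then show ?thesis by (rule const[OF zero_in_I t, symmetric])
  next
    case False
    then have "t \<le> 0" by linarith
    then show ?thesis by (rule const[OF t zero_in_I])
  qed
  then show ?thesis unfolding k_def by linarith
qed

text \<open>While \<open>h\<close> stays in a compact subset of the positive half-line, the solution stays in a compact
  part of its domain, so it does not end. As \<open>h\<close> increases, it is bounded below by \<open>h 0\<close> to the
  right of time zero, so the upper bound \<open>u\<close> suffices there.\<close>

lemma extends_right:
  assumes T: "b = ereal T" and bound: "\<And>t. t \<in> I \<Longrightarrow> h t \<le> u"
  shows "\<exists>b'>b. \<exists>H' h'. solves_ivp (scaled_flow \<alpha> \<beta> F) (H 0, h 0) a b' H' h' \<and>
    (\<forall>t\<in>I. H' t = H t \<and> h' t = h t)"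
proof -
  have T0: "0 < T" using b T by simp
  have inI: "t \<in> I" if "a < ereal t" "t < T" for t unfolding I_def using that T by simp
  obtain K where K: "compact K" "K \<subseteq> flow_domain"
    "\<And>t. t \<in> I \<Longrightarrow> h 0 \<le> h t \<Longrightarrow> (H t, h t) \<in> K"
    using stays_in_compact[of "h 0" u] pos(2)[OF zero_in_I] bound bound[OF zero_in_I] by blast
  have "\<exists>\<delta>>0. \<exists>z. (\<forall>t<T. z t = (H t, h t)) \<and>
    (\<forall>t. a < ereal t \<and> t < T + \<delta> \<longrightarrow> z t \<in> flow_domain \<and>
      (z has_vector_derivative scaled_flow \<alpha> \<beta> F (z t)) (at t))"
  proof (rule solution_continues_right[where d = 0, OF _ T0 _ K(1,2) _ continuous_on_scaled_flow])
    show "a < ereal 0" using a by (simp only: zero_ereal_def)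
    show "(H t, h t) \<in> flow_domain \<and>
        ((\<lambda>t. (H t, h t)) has_vector_derivative scaled_flow \<alpha> \<beta> F (H t, h t)) (at t)"
      if "a < ereal t" "t < T" for t
      using solution[of t] that T by (simp add: flow_domain_def)
    show "(H t, h t) \<in> K" if "0 < t" "t < T" for t
    proof -
      have "a < ereal t" using a that(1) by (meson ereal_less(2) less_trans)
      then have t: "t \<in> I" using inI that(2) by blast
      then show ?thesis using K(3)[OF t] h_mono[OF zero_in_I t] that(1) by simp
    qed
    show "\<exists>\<delta>>0. \<exists>y. y 0 = p \<and> (\<forall>t\<in>{0..\<delta>}. y t \<in> flow_domain \<and>
        (y has_vector_derivative scaled_flow \<alpha> \<beta> F (y t)) (at t within {0..\<delta>}))"
      if "p \<in> flow_domain" for p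
      using scaled_flow_local_solution[OF that, of 1 \<alpha> \<beta> F] by simp
  qed
  then obtain \<delta> z where z: "\<delta> > 0" "\<And>t. t < T \<Longrightarrow> z t = (H t, h t)"
    "\<And>t. a < ereal t \<Longrightarrow> t < T + \<delta> \<Longrightarrow> z t \<in> flow_domain \<and>
      (z has_vector_derivative scaled_flow \<alpha> \<beta> F (z t)) (at t)" by blast
  have "solves_ivp (scaled_flow \<alpha> \<beta> F) (H 0, h 0) a (ereal (T + \<delta>)) (\<lambda>t. fst (z t)) (\<lambda>t. snd (z t))"
    using z(3) z(2)[OF T0] a T0 z(1)
    by (auto simp: solves_ivp_def flow_domain_def mem_Times_iff)
  moreover have "\<forall>t\<in>I. fst (z t) = H t \<and> snd (z t) = h t" unfolding I_def using z(2) T by simp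
  moreover have "ereal (T + \<delta>) > b" using T z(1) by simp
  ultimately show ?thesis by blast
qed

text \<open>To the left of time zero it is \<open>h 0\<close> that bounds \<open>h\<close> from above.\<close>

lemma extends_left:
  assumes T: "a = ereal T" and bound: "\<And>t. t \<in> I \<Longrightarrow> l \<le> h t" and l: "l > 0"
  shows "\<exists>a'<a. \<exists>H' h'. solves_ivp (scaled_flow \<alpha> \<beta> F) (H 0, h 0) a' b H' h' \<and>
    (\<forall>t\<in>I. H' t = H t \<and> h' t = h t)"
proof -
  have T0: "T < 0" using a T by simp
  have inI: "t \<in> I" if "T < t" "ereal t < b" for t unfolding I_def using that T by simp
  obtain K where K: "compact K" "K \<subseteq> flow_domain"
    "\<And>t. t \<in> I \<Longrightarrow> h t \<le> h 0 \<Longrightarrow> (H t, h t) \<in> K"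
    using stays_in_compact[of l "h 0"] l bound bound[OF zero_in_I] by blast
  have "\<exists>\<delta>>0. \<exists>z. (\<forall>t>T. z t = (H t, h t)) \<and>
    (\<forall>t. T - \<delta> < t \<and> ereal t < b \<longrightarrow> z t \<in> flow_domain \<and>
      (z has_vector_derivative scaled_flow \<alpha> \<beta> F (z t)) (at t))"
  proof (rule solution_continues_left[where d = 0, OF _ T0 _ K(1,2) _ continuous_on_scaled_flow])
    show "ereal 0 < b" using b by (simp only: zero_ereal_def)
    show "(H t, h t) \<in> flow_domain \<and>
        ((\<lambda>t. (H t, h t)) has_vector_derivative scaled_flow \<alpha> \<beta> F (H t, h t)) (at t)"
      if "T < t" "ereal t < b" for t
      using solution[of t] that T by (simp add: flow_domain_def)
    show "(H t, h t) \<in> K" if "T < t" "t < 0" for t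
    proof -
      have "ereal t < b" using less_trans[of "ereal t" 0 b] b that(2) by simp
      then have t: "t \<in> I" using inI that(1) by blast
      then show ?thesis using K(3)[OF t] h_mono[OF t zero_in_I] that(2) by simp
    qed
    show "\<exists>\<delta>>0. \<exists>y. y 0 = p \<and> (\<forall>t\<in>{0..\<delta>}. y t \<in> flow_domain \<and>
        (y has_vector_derivative - scaled_flow \<alpha> \<beta> F (y t)) (at t within {0..\<delta>}))"
      if "p \<in> flow_domain" for p
      using scaled_flow_local_solution[OF that, of "-1" \<alpha> \<beta> F] by simp
  qed
  then obtain \<delta> z where z: "\<delta> > 0" "\<And>t. T < t \<Longrightarrow> z t = (H t, h t)"
    "\<And>t. T - \<delta> < t \<Longrightarrow> ereal t < b \<Longrightarrow> z t \<in> flow_domain \<and>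
      (z has_vector_derivative scaled_flow \<alpha> \<beta> F (z t)) (at t)" by blast
  have "solves_ivp (scaled_flow \<alpha> \<beta> F) (H 0, h 0) (ereal (T - \<delta>)) b (\<lambda>t. fst (z t)) (\<lambda>t. snd (z t))"
    using z(3) z(2)[OF T0] b T0 z(1)
    by (auto simp: solves_ivp_def flow_domain_def mem_Times_iff)
  moreover have "\<forall>t\<in>I. fst (z t) = H t \<and> snd (z t) = h t" unfolding I_def using z(2) T by simp
  moreover have "ereal (T - \<delta>) < a" using T z(1) by simp
  ultimately show ?thesis by blast
qed

lemma h_growth:
  assumes c: "\<And>X. X \<in> Sym_plus \<Longrightarrow> c \<le> flow_scalar F X" and st: "s \<in> I" "t \<in> I" "s \<le> t"
  shows "h s + \<beta> * c * (t - s) \<le> h t"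
proof -
  have "h s - \<beta> * c * s \<le> h t - \<beta> * c * t"
  proof (rule DERIV_nonneg_imp_nondecreasing[OF st(3)])
    fix x assume "s \<le> x" "x \<le> t"
    then have x: "x \<in> I" using I_between st by blast
    have "((\<lambda>t. h t - \<beta> * c * t) has_real_derivative \<beta> * flow_scalar F (H x) - \<beta> * c * 1) (at x)"
      by (intro DERIV_diff DERIV_cmult DERIV_ident h_deriv x)
    moreover have "0 \<le> \<beta> * flow_scalar F (H x) - \<beta> * c * 1"
      using mult_left_mono[OF c[OF pos(1)[OF x]], of \<beta>] \<beta> by simp
    ultimately show "\<exists>y. ((\<lambda>t. h t - \<beta> * c * t) has_real_derivative y) (at x) \<and> 0 \<le> y" by blast
  qed
  then show ?thesis by (simp add: algebra_simps)
qed

lemma eventually_near_left_end: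
  assumes "t0 \<in> I" "\<And>t. t \<in> I \<Longrightarrow> t < t0 \<Longrightarrow> P t"
  shows "eventually (\<lambda>x. P (real_of_ereal x)) (at_right a)"
proof -
  have "a < ereal t0" using assms(1) by (simp add: I_def)
  moreover have "P (real_of_ereal x)" if x: "a < x" "x < ereal t0" for x
  proof -
    have "ereal (real_of_ereal x) = x" using x by (cases x) auto
    moreover have "x < b" using x assms(1) by (auto simp: I_def)
    ultimately show ?thesis using x by (intro assms(2)) (auto simp: I_def simp flip: ereal_less_eq(3) less_ereal.simps(1))
  qed
  ultimately show ?thesis unfolding eventually_at_right[OF \<open>a < ereal t0\<close>] by blast
qed

lemma eventually_near_right_end:
  assumes "t0 \<in> I" "\<And>t. t \<in> I \<Longrightarrow> t0 < t \<Longrightarrow> P t"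
  shows "eventually (\<lambda>x. P (real_of_ereal x)) (at_left b)"
proof -
  have "ereal t0 < b" using assms(1) by (simp add: I_def)
  moreover have "P (real_of_ereal x)" if x: "ereal t0 < x" "x < b" for x
  proof -
    have "ereal (real_of_ereal x) = x" using x by (cases x) auto
    moreover have "a < x" using x assms(1) by (auto simp: I_def)
    ultimately show ?thesis using x by (intro assms(2)) (auto simp: I_def simp flip: ereal_less_eq(3) less_ereal.simps(1))
  qed
  ultimately show ?thesis unfolding eventually_at_left[OF \<open>ereal t0 < b\<close>] by blast
qed

lemma det_at_left_end:
  assumes "((h \<circ> real_of_ereal) \<longlongrightarrow> 0) (at_right a)"
  shows "filterlim ((\<lambda>t. det (H t)) \<circ> real_of_ereal) at_top (at_right a)"
proof -
  define \<kappa> where "\<kappa> = \<alpha> * real CARD('m) / (64 * \<beta>)"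
  define C where "C = ln (det (H 0)) + \<kappa> * ln (h 0)"
  have \<kappa>: "\<kappa> > 0" using \<alpha> \<beta> by (simp add: \<kappa>_def)
  have "eventually (\<lambda>x. h (real_of_ereal x) > 0) (at_right a)"
    by (rule eventually_near_left_end[OF zero_in_I]) (rule pos(2))
  then have "filterlim (\<lambda>x. h (real_of_ereal x)) (at_right 0) (at_right a)"
    using assms by (intro tendsto_imp_filterlim_at_right) (auto simp: o_def)
  then have "filterlim (\<lambda>x. ln (h (real_of_ereal x))) at_bot (at_right a)"
    by (rule filterlim_compose[OF ln_at_0])
  then have "filterlim (\<lambda>x. \<kappa> * ln (h (real_of_ereal x))) at_bot (at_right a)"
    by (rule filterlim_tendsto_pos_mult_at_bot[OF tendsto_const \<kappa>])
  then have "filterlim (\<lambda>x. - (\<kappa> * ln (h (real_of_ereal x)))) at_top (at_right a)"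
    by (simp only: filterlim_uminus_at_bot)
  then have "filterlim (\<lambda>x. C + - (\<kappa> * ln (h (real_of_ereal x)))) at_top (at_right a)"
    by (rule filterlim_tendsto_add_at_top[OF tendsto_const])
  then have "filterlim (\<lambda>x. exp (C + - (\<kappa> * ln (h (real_of_ereal x))))) at_top (at_right a)"
    by (rule filterlim_compose[OF exp_at_top])
  moreover have "eventually (\<lambda>x. exp (C + - (\<kappa> * ln (h (real_of_ereal x)))) = det (H (real_of_ereal x))) (at_right a)"
  proof (rule eventually_near_left_end[OF zero_in_I])
    fix t assume t: "t \<in> I"
    have "C + - (\<kappa> * ln (h t)) = ln (det (H t))"
      using det_conserved[OF t] by (simp add: C_def \<kappa>_def)
    then show "exp (C + - (\<kappa> * ln (h t))) = det (H t)"
      using Sym_plus_inverse(3)[OF pos(1)[OF t]] by simp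
  qed
  ultimately show ?thesis unfolding o_def by (rule filterlim_mono_eventually[OF _ order_refl order_refl])
qed

lemma det_at_right_end:
  assumes "filterlim (h \<circ> real_of_ereal) at_top (at_left b)"
  shows "(((\<lambda>t. det (H t)) \<circ> real_of_ereal) \<longlongrightarrow> 0) (at_left b)"
proof -
  define \<kappa> where "\<kappa> = \<alpha> * real CARD('m) / (64 * \<beta>)"
  define C where "C = ln (det (H 0)) + \<kappa> * ln (h 0)"
  have \<kappa>: "\<kappa> > 0" using \<alpha> \<beta> by (simp add: \<kappa>_def)
  have "filterlim (\<lambda>x. ln (h (real_of_ereal x))) at_top (at_left b)"
    using filterlim_compose[OF ln_at_top assms] by (simp add: o_def)
  then have "filterlim (\<lambda>x. - C + \<kappa> * ln (h (real_of_ereal x))) at_top (at_left b)"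
    by (intro filterlim_tendsto_add_at_top[OF tendsto_const] filterlim_tendsto_pos_mult_at_top[OF tendsto_const \<kappa>])
  then have "filterlim (\<lambda>x. - (- C + \<kappa> * ln (h (real_of_ereal x)))) at_bot (at_left b)"
    by (simp only: filterlim_uminus_at_top)
  then have "((\<lambda>x. exp (- (- C + \<kappa> * ln (h (real_of_ereal x))))) \<longlongrightarrow> 0) (at_left b)"
    by (rule filterlim_compose[OF exp_at_bot])
  moreover have "eventually (\<lambda>x. exp (- (- C + \<kappa> * ln (h (real_of_ereal x)))) = det (H (real_of_ereal x))) (at_left b)"
  proof (rule eventually_near_right_end[OF zero_in_I])
    fix t assume t: "t \<in> I"
    have "- (- C + \<kappa> * ln (h t)) = ln (det (H t))"
      using det_conserved[OF t] by (simp add: C_def \<kappa>_def)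
    then show "exp (- (- C + \<kappa> * ln (h t))) = det (H t)"
      using Sym_plus_inverse(3)[OF pos(1)[OF t]] by simp
  qed
  ultimately show ?thesis unfolding o_def by (rule Lim_transform_eventually)
qed

text \<open>The function \<open>h\<close> grows at least linearly. Going backwards it would become negative, so the
  solution has a first time, and there \<open>h\<close> tends to zero as otherwise the solution would extend.
  Going forwards, \<open>h\<close> becomes arbitrarily large, by linear growth if the solution lives forever and
  again by maximality if not.\<close>

lemma maximal_behaviour:
  assumes max: "maximal_solution (scaled_flow \<alpha> \<beta> F) (H 0, h 0) a b H h"
    and c: "c > 0" "\<And>X. X \<in> Sym_plus \<Longrightarrow> c \<le> flow_scalar F X"
  shows "(\<exists>\<tau>::real. a = ereal \<tau>) \<and>
    ((h \<circ> real_of_ereal) \<longlongrightarrow> 0) (at_right a) \<and>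
    filterlim ((\<lambda>t. det (H t)) \<circ> real_of_ereal) at_top (at_right a) \<and>
    filterlim (h \<circ> real_of_ereal) at_top (at_left b) \<and>
    (((\<lambda>t. det (H t)) \<circ> real_of_ereal) \<longlongrightarrow> 0) (at_left b)"
proof -
  have ext: "a' = a \<and> b' = b"
    if "solves_ivp (scaled_flow \<alpha> \<beta> F) (H 0, h 0) a' b' H' h'" "a' \<le> a" "b \<le> b'"
      "\<forall>t\<in>I. H' t = H t \<and> h' t = h t" for a' b' H' h'
    using max that unfolding maximal_solution_def I_def by blast
  have \<beta>c: "\<beta> * c > 0" using \<beta> c by simp
  have a_fin: "\<exists>\<tau>. a = ereal \<tau>"
  proof (cases a)
    case MInf
    \<comment> \<open>Linear growth from time \<open>?t\<close> on would force \<open>h ?t \<le> 0\<close>.\<close>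
    let ?t = "- (h 0 / (\<beta> * c))"
    have "h 0 > 0" using pos(2)[OF zero_in_I] .
    then have t: "?t \<le> 0" using \<beta>c by simp
    then have "ereal ?t < b" using b by (meson ereal_less_eq(3) le_less_trans zero_ereal_def ereal_less_eq(4))
    then have tI: "?t \<in> I" unfolding I_def using MInf by simp
    have "h ?t + \<beta> * c * (0 - ?t) \<le> h 0" by (rule h_growth[OF c(2) tI zero_in_I t])
    moreover have "\<beta> * c * (0 - ?t) = h 0" using \<beta> c(1) by simp
    ultimately have "h ?t \<le> 0" by linarith
    then show ?thesis using pos(2)[OF tI] by linarith
  qed (use a in auto)
  then obtain \<tau> where \<tau>: "a = ereal \<tau>" ..
  have small: "\<exists>t\<in>I. h t < l" if l: "l > 0" for l
  proof (rule ccontr)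
    assume "\<not> ?thesis"
    then obtain a' H' h' where "a' < a" "solves_ivp (scaled_flow \<alpha> \<beta> F) (H 0, h 0) a' b H' h'"
      "\<forall>t\<in>I. H' t = H t \<and> h' t = h t"
      using extends_left[OF \<tau> _ l] by force
    then show False using ext[of a' b H' h'] less_imp_le[of a' a] by simp
  qed
  have h0: "((h \<circ> real_of_ereal) \<longlongrightarrow> 0) (at_right a)"
  proof (rule tendstoI)
    fix e :: real assume "e > 0"
    then obtain t0 where t0: "t0 \<in> I" "h t0 < e" using small by blast
    have "dist (h t) 0 < e" if "t \<in> I" "t < t0" for t
      using h_mono[OF that(1) t0(1)] that(2) t0(2) pos(2)[OF that(1)] by simp
    from eventually_near_left_end[OF t0(1) this]
    show "eventually (\<lambda>x. dist ((h \<circ> real_of_ereal) x) 0 < e) (at_right a)" by simp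
  qed
  have large: "\<exists>t\<in>I. h t > u" for u
  proof (cases b)
    case (real T)
    show ?thesis
    proof (rule ccontr)
      assume "\<not> ?thesis"
      then obtain b' H' h' where "b' > b" "solves_ivp (scaled_flow \<alpha> \<beta> F) (H 0, h 0) a b' H' h'"
        "\<forall>t\<in>I. H' t = H t \<and> h' t = h t"
        using extends_right[OF real, of u] by force
      then show False using ext[of a b' H' h'] less_imp_le[of b b'] by simp
    qed
  next
    case PInf
    let ?t = "(\<bar>u\<bar> + 1) / (\<beta> * c)"
    have t: "0 \<le> ?t" using \<beta>c by simp
    then have "a < ereal ?t" using a by (meson ereal_less_eq(5) less_le_trans)
    then have tI: "?t \<in> I" unfolding I_def using PInf by simp
    have "h 0 + \<beta> * c * (?t - 0) \<le> h ?t" by (rule h_growth[OF c(2) zero_in_I tI t])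
    moreover have "\<beta> * c * (?t - 0) = \<bar>u\<bar> + 1" using \<beta> c(1) by simp
    ultimately have "h 0 + (\<bar>u\<bar> + 1) \<le> h ?t" by linarith
    then show ?thesis using pos(2)[OF zero_in_I] tI by (intro bexI[of _ ?t]) auto
  qed (use b in auto)
  have htop: "filterlim (h \<circ> real_of_ereal) at_top (at_left b)"
    unfolding filterlim_at_top
  proof
    fix u
    obtain t0 where t0: "t0 \<in> I" "h t0 > u" using large by blast
    have "u \<le> h t" if "t \<in> I" "t0 < t" for t
      using h_mono[OF t0(1) that(1)] that(2) t0(2) by simp
    from eventually_near_right_end[OF t0(1) this]
    show "eventually (\<lambda>x. u \<le> (h \<circ> real_of_ereal) x) (at_left b)" by simp
  qed
  show ?thesis using a_fin h0 htop det_at_left_end[OF h0] det_at_right_end[OF htop] by blast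
qed

end

section \<open>The adjoint action on the abelian ideal\<close>

text \<open>If the zero function is smooth, this is homogeneity; if not, it is the convention that vector fields
  vanish on functions that are not smooth.\<close>

lemma vector_field_zero:
  assumes "D \<in> vector_fields G"
  shows "D 0 = 0"
proof (cases "0 \<in> smooth_functions G")
  case True
  then have "D (0 *\<^sub>R 0) = 0 *\<^sub>R D 0" using assms unfolding vector_fields_def by blast
  then show ?thesis by simp
next
  case False
  then show ?thesis using assms by (simp add: vector_fields_def)
qed

lemma vector_field_smooth: "D \<in> vector_fields G \<Longrightarrow> f \<in> smooth_functions G \<Longrightarrow> D f \<in> smooth_functions G"
  and vector_field_not_smooth: "D \<in> vector_fields G \<Longrightarrow> f \<notin> smooth_functions G \<Longrightarrow> D f = 0"
  and vector_field_add: "D \<in> vector_fields G \<Longrightarrow> f \<in> smooth_functions G \<Longrightarrow> g \<in> smooth_functions G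
    \<Longrightarrow> D (f + g) = D f + D g"
  and vector_field_scaleR: "D \<in> vector_fields G \<Longrightarrow> f \<in> smooth_functions G \<Longrightarrow> D (c *\<^sub>R f) = c *\<^sub>R D f"
  unfolding vector_fields_def by blast+

lemma lie_bracket_add_left:
  assumes P: "P \<in> vector_fields G" and Q: "Q \<in> vector_fields G" and U: "U \<in> vector_fields G"
  shows "lie_bracket (P + Q) U = lie_bracket P U + lie_bracket Q U"
proof
  fix f
  have plus: "(A + B) g = A g + B g" for A B :: "'a vector_field" and g
    by (subst plus_fun_def) (rule refl)
  have "U (P f + Q f) = U (P f) + U (Q f)"
  proof (cases "f \<in> smooth_functions G")
    case True
    then show ?thesis
      using vector_field_add[OF U vector_field_smooth[OF P] vector_field_smooth[OF Q]] by blast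
  next
    case False
    then show ?thesis
      by (simp add: vector_field_not_smooth[OF P] vector_field_not_smooth[OF Q] vector_field_zero[OF U])
  qed
  then show "lie_bracket (P + Q) U f = (lie_bracket P U + lie_bracket Q U) f"
    unfolding lie_bracket_def plus by simp
qed

lemma lie_bracket_scaleR_left:
  assumes P: "P \<in> vector_fields G" and U: "U \<in> vector_fields G"
  shows "lie_bracket (c *\<^sub>R P) U = c *\<^sub>R lie_bracket P U"
proof
  fix f
  have scale: "(c *\<^sub>R A) g = c *\<^sub>R A g" for A :: "'a vector_field" and g
    by (subst scaleR_fun_def) (rule refl)
  have "U (c *\<^sub>R P f) = c *\<^sub>R U (P f)"
  proof (cases "f \<in> smooth_functions G")
    case True
    then show ?thesis using vector_field_scaleR[OF U vector_field_smooth[OF P]] by blast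
  next
    case False
    then show ?thesis by (simp add: vector_field_not_smooth[OF P] vector_field_zero[OF U])
  qed
  then show "lie_bracket (c *\<^sub>R P) U f = (c *\<^sub>R lie_bracket P U) f"
    unfolding lie_bracket_def scale by (simp add: scaleR_diff_right)
qed

lemma lie_bracket_swap: "lie_bracket P U = - lie_bracket U P"
  by (simp add: lie_bracket_def fun_eq_iff)

lemma lie_bracket_add_right:
  assumes "P \<in> vector_fields G" "Q \<in> vector_fields G" "U \<in> vector_fields G"
  shows "lie_bracket U (P + Q) = lie_bracket U P + lie_bracket U Q"
  unfolding lie_bracket_swap[of U] lie_bracket_add_left[OF assms] by (rule minus_add_distrib)

lemma lie_bracket_scaleR_right:
  assumes "P \<in> vector_fields G" "U \<in> vector_fields G"
  shows "lie_bracket U (c *\<^sub>R P) = c *\<^sub>R lie_bracket U P"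
  unfolding lie_bracket_swap[of U] lie_bracket_scaleR_left[OF assms] by (rule scaleR_minus_right[symmetric])

lemma lie_bracket_zero_right:
  assumes "P \<in> vector_fields G"
  shows "lie_bracket P 0 = 0"
proof
  fix f
  have "(0 :: 'a vector_field) g = 0" for g by (subst zero_fun_def) (rule refl)
  then show "lie_bracket P 0 f = 0 f"
    unfolding lie_bracket_def by (simp only: vector_field_zero[OF assms] diff_self)
qed

lemma lie_bracket_sum_right:
  assumes S: "subspace S" "S \<subseteq> vector_fields G" and P: "P \<in> S" and X: "\<And>j. X j \<in> S" and "finite J"
  shows "lie_bracket P (\<Sum>j\<in>J. c j *\<^sub>R X j) = (\<Sum>j\<in>J. c j *\<^sub>R lie_bracket P (X j))"
  using \<open>finite J\<close>
proof (induction J rule: finite_induct)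
  case empty
  have "P \<in> vector_fields G" using P S(2) by blast
  then show ?case by (simp only: sum.empty lie_bracket_zero_right)
next
  case (insert j J)
  have "(\<Sum>j\<in>J. c j *\<^sub>R X j) \<in> S" "c j *\<^sub>R X j \<in> S"
    using S(1) X by (auto intro: subspace_sum subspace_scale)
  then have "lie_bracket P (c j *\<^sub>R X j + (\<Sum>j\<in>J. c j *\<^sub>R X j))
      = lie_bracket P (c j *\<^sub>R X j) + lie_bracket P (\<Sum>j\<in>J. c j *\<^sub>R X j)"
    using S(2) P by (intro lie_bracket_add_right) auto
  also have "lie_bracket P (c j *\<^sub>R X j) = c j *\<^sub>R lie_bracket P (X j)"
    using S(2) P X by (intro lie_bracket_scaleR_right) auto
  finally show ?case by (simp only: sum.insert[OF insert.hyps] insert.IH)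
qed

text \<open>The sum of exponents that work for the vectors of the standard basis works for all vectors.\<close>

lemma nilpotent_matrix_if_orbits_vanish:
  fixes F :: "real^'m^'m"
  assumes "\<And>v. \<exists>k. ((*v) F ^^ k) v = 0"
  shows "\<exists>K. \<forall>v. ((*v) F ^^ K) v = 0"
proof -
  have "\<forall>j. \<exists>k. ((*v) F ^^ k) (axis j 1) = 0" using assms by blast
  then obtain k where k: "\<And>j. ((*v) F ^^ k j) (axis j 1) = 0"
    using choice[of "\<lambda>j k. ((*v) F ^^ k) (axis j 1) = 0"] by blast
  define K where "K = (\<Sum>j\<in>UNIV. k j)"
  have zero: "((*v) F ^^ i) 0 = 0" for i by (induction i) simp_all
  have ax: "((*v) F ^^ K) (axis j 1) = 0" for j
  proof -
    have "k j \<le> K" unfolding K_def by (intro member_le_sum) auto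
    then have "K = (K - k j) + k j" by simp
    then show ?thesis by (metis comp_apply funpow_add k zero)
  qed
  have "\<exists>M. (*v) F ^^ i = (*v) M" for i
  proof (induction i)
    case 0
    have "(*v) F ^^ 0 = (*v) (mat 1)" by (simp add: fun_eq_iff)
    then show ?case ..
  next
    case (Suc i)
    then obtain M where "(*v) F ^^ i = (*v) M" ..
    then have "(*v) F ^^ Suc i = (*v) (F ** M)" by (simp add: fun_eq_iff matrix_vector_mul_assoc)
    then show ?case ..
  qed
  then obtain M where M: "(*v) F ^^ K = (*v) M" by blast
  have "column j M = 0" for j using ax[of j] by (simp add: M matrix_vector_mult_basis)
  then have "M = 0" by (simp add: vec_eq_iff column_def)
  then show ?thesis using M by (intro exI[of _ K]) simp
qed

text \<open>Write \<open>Y = c X\<^sub>n + U\<close> with \<open>U \<in> \<uu>\<close>. As \<open>\<uu>\<close> is abelian, bracketing with \<open>Y\<close> acts on \<open>\<uu>\<close> as \<open>c\<close>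
  times bracketing with \<open>X\<^sub>n\<close>, which in coordinates is \<open>c F\<close>. So nilpotency of \<open>F\<close> would pass to
  \<open>Y\<close>.\<close>

lemma ad_not_nilpotent_imp_matrix_not_nilpotent:
  fixes X :: "'m::finite \<Rightarrow> 'g vector_field" and F :: "real^'m^'m"
  assumes \<gg>: "\<gg> \<subseteq> vector_fields G"
    and \<uu>: "codim1_abelian_ideal \<uu> \<gg>" and Y: "Y \<in> \<gg>"
    and nn: "\<not> nilpotent_on \<uu> (lie_bracket Y)"
    and basis_\<gg>: "basis_family (case_option Xn X) \<gg>" and basis_\<uu>: "basis_family X \<uu>"
    and F: "\<And>j. lie_bracket Xn (X j) = (\<Sum>i\<in>UNIV. F $ i $ j *\<^sub>R X i)"
  shows "\<exists>v. \<forall>k. ((*v) F ^^ k) v \<noteq> 0"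
proof (rule ccontr)
  assume "\<not> ?thesis"
  then obtain K where K: "\<And>v. ((*v) F ^^ K) v = 0" using nilpotent_matrix_if_orbits_vanish by blast
  have rng: "range (case_option Xn X) = insert Xn (range X)"
  proof -
    have "range (case_option Xn X) = case_option Xn X ` insert None (range Some)"
      by (simp add: UNIV_option_conv)
    then show ?thesis by (simp add: image_image)
  qed
  have span\<gg>: "span (insert Xn (range X)) = \<gg>" using basis_\<gg> by (simp add: basis_family_def rng)
  have span\<uu>: "span (range X) = \<uu>" and inj: "inj X" using basis_\<uu> by (simp_all add: basis_family_def)
  have sub\<gg>: "subspace \<gg>" unfolding span\<gg>[symmetric] by (rule subspace_span)
  have Xn: "Xn \<in> \<gg>" unfolding span\<gg>[symmetric] by (rule span_base) simp
  have X\<uu>: "X j \<in> \<uu>" for j unfolding span\<uu>[symmetric] by (rule span_base) simp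
  have \<uu>\<gg>: "\<uu> \<subseteq> \<gg>" and ab: "\<And>U V. U \<in> \<uu> \<Longrightarrow> V \<in> \<uu> \<Longrightarrow> lie_bracket U V = 0" and sub\<uu>: "subspace \<uu>"
    using \<uu> by (auto simp: codim1_abelian_ideal_def)
  define L where "L = (\<lambda>v :: real^'m. \<Sum>j\<in>UNIV. v $ j *\<^sub>R X j)"
  have L_in: "L v \<in> \<uu>" for v
    unfolding L_def using sub\<uu> X\<uu> by (intro subspace_sum subspace_scale) auto
  obtain c where c: "Y - c *\<^sub>R Xn \<in> \<uu>"
    using Y unfolding span\<gg>[symmetric] span_breakdown_eq span\<uu> by blast
  have step: "lie_bracket Y (L v) = c *\<^sub>R L (F *v v)" for v
  proof -
    have Lg: "L v \<in> vector_fields G" using L_in \<uu>\<gg> \<gg> by blast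
    have "c *\<^sub>R Xn \<in> \<gg>" by (rule subspace_scale[OF sub\<gg> Xn])
    then have "lie_bracket (c *\<^sub>R Xn + (Y - c *\<^sub>R Xn)) (L v)
        = lie_bracket (c *\<^sub>R Xn) (L v) + lie_bracket (Y - c *\<^sub>R Xn) (L v)"
      using c \<uu>\<gg> \<gg> Lg by (intro lie_bracket_add_left) auto
    also have "lie_bracket (Y - c *\<^sub>R Xn) (L v) = 0" by (rule ab[OF c L_in])
    also have "lie_bracket (c *\<^sub>R Xn) (L v) = c *\<^sub>R lie_bracket Xn (L v)"
      using Xn \<gg> Lg by (intro lie_bracket_scaleR_left) auto
    also have "lie_bracket Xn (L v) = (\<Sum>j\<in>UNIV. v $ j *\<^sub>R lie_bracket Xn (X j))"
      unfolding L_def using X\<uu> \<uu>\<gg> by (intro lie_bracket_sum_right[OF sub\<gg> \<gg> Xn]) auto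
    also have "\<dots> = (\<Sum>j\<in>UNIV. \<Sum>i\<in>UNIV. (F $ i $ j * v $ j) *\<^sub>R X i)"
      by (simp add: F scaleR_sum_right mult.commute)
    also have "\<dots> = (\<Sum>i\<in>UNIV. \<Sum>j\<in>UNIV. (F $ i $ j * v $ j) *\<^sub>R X i)" by (rule sum.swap)
    also have "\<dots> = L (F *v v)" by (simp add: L_def matrix_vector_mult_def scaleR_sum_left)
    also have "c *\<^sub>R Xn + (Y - c *\<^sub>R Xn) = Y" by (metis add.commute diff_add_cancel)
    finally show ?thesis by (simp only: add_0_right)
  qed
  have L_scale: "L (r *\<^sub>R v) = r *\<^sub>R L v" for r v by (simp add: L_def scaleR_sum_right)
  have L0: "L 0 = 0" using L_scale[of 0 0] by (simp only: scaleR_zero_left)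
  have pow: "(lie_bracket Y ^^ k) (L v) = L (c ^ k *\<^sub>R ((*v) F ^^ k) v)" for k v
    by (induction k) (simp_all add: step matrix_vector_mult_scaleR L_scale[symmetric])
  have "(lie_bracket Y ^^ K) U = 0" if U: "U \<in> \<uu>" for U
  proof -
    obtain w where "U = (\<Sum>x\<in>range X. w x *\<^sub>R x)"
      using U unfolding span\<uu>[symmetric] span_finite[OF finite_imageI[OF finite_class.finite_UNIV]] by blast
    also have "\<dots> = L (\<chi> j. w (X j))" by (simp add: L_def sum.reindex[OF inj])
    finally show ?thesis by (simp only: pow K scaleR_zero_right L0)
  qed
  then show False using nn unfolding nilpotent_on_def by blast
qed

section \<open>Limits along the homogeneous spinor flows\<close>

theorem theorem6p4:
  fixes G :: "('g, 'e::euclidean_space) lie_structure"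
    and n :: nat
    and \<gg> \<uu> :: "'g vector_field set"
    and Y :: "'g vector_field"
    and X :: "'m::finite \<Rightarrow> 'g vector_field" and X\<^sub>n :: "'g vector_field"
    and F H\<^sub>0 :: "real^'m^'m" and h\<^sub>0 :: real
    and g\<^sub>0 :: "'g vector_field \<Rightarrow> 'g vector_field \<Rightarrow> real"
    and H :: "real \<Rightarrow> real^'m^'m" and h :: "real \<Rightarrow> real"
    and Tminus Tplus :: ereal
  assumes n: "n \<ge> 3" "DIM('e) = n" "CARD('m) = n - 1"
    and G: "lie_group G" "almost_abelian G"
    and \<gg>: "\<gg> = lie_algebra G"
    and \<uu>: "codim1_abelian_ideal \<uu> \<gg>"
    and Y: "Y \<in> \<gg> - \<uu>"
    and not_nilpotent: "\<not> nilpotent_on \<uu> (lie_bracket Y)"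
    and dim_or_scalar: "n \<le> 4 \<or> (\<exists>c::real. \<forall>U\<in>\<uu>. lie_bracket Y U = c *\<^sub>R U)"
    and basis_\<gg>: "basis_family (case_option X\<^sub>n X) \<gg>"
    and basis_\<uu>: "basis_family X \<uu>"
    and F: "\<And>j. lie_bracket X\<^sub>n (X j) = (\<Sum>i\<in>UNIV. F $ i $ j *\<^sub>R X i)"
    and g\<^sub>0: "inner_product_on \<gg> g\<^sub>0"
    and orthogonal: "\<And>U. U \<in> \<uu> \<Longrightarrow> g\<^sub>0 X\<^sub>n U = 0"
    and initial: "\<And>i j. H\<^sub>0 $ i $ j = g\<^sub>0 (X i) (X j)" "h\<^sub>0 = g\<^sub>0 X\<^sub>n X\<^sub>n"
    and flow: "maximal_solution (spinor_flow F) (H\<^sub>0, h\<^sub>0) Tminus Tplus H h \<or>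
      maximal_solution (normalized_spinor_flow n F) (H\<^sub>0, h\<^sub>0) Tminus Tplus H h"
  shows "(\<exists>\<tau>::real. Tminus = ereal \<tau>) \<and>
    ((h \<circ> real_of_ereal) \<longlongrightarrow> 0) (at_right Tminus) \<and>
    filterlim ((\<lambda>t. det (H t)) \<circ> real_of_ereal) at_top (at_right Tminus) \<and>
    filterlim (h \<circ> real_of_ereal) at_top (at_left Tplus) \<and>
    (((\<lambda>t. det (H t)) \<circ> real_of_ereal) \<longlongrightarrow> 0) (at_left Tplus)"
proof -
  have "\<gg> \<subseteq> vector_fields G" unfolding \<gg> lie_algebra_def by blast
  then have "\<exists>v. \<forall>k. ((*v) F ^^ k) v \<noteq> 0"
    using Y by (intro ad_not_nilpotent_imp_matrix_not_nilpotent[OF _ \<uu> _ not_nilpotent basis_\<gg> basis_\<uu> F]) auto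
  then obtain c where c: "c > 0" "\<And>M. M \<in> Sym_plus \<Longrightarrow> c \<le> flow_scalar F M"
    using flow_scalar_bounded_below by blast
  have flows: "spinor_flow F = scaled_flow 1 (1 / 64) F"
    "normalized_spinor_flow n F = scaled_flow (2 / real n) ((real n - 1) / (32 * real n)) F"
    by (simp_all add: spinor_flow_def normalized_spinor_flow_def scaled_flow_def)
  obtain \<alpha> \<beta> where pos: "\<alpha> > 0" "\<beta> > 0"
    and max: "maximal_solution (scaled_flow \<alpha> \<beta> F) (H\<^sub>0, h\<^sub>0) Tminus Tplus H h"
    using flow
  proof
    assume "maximal_solution (spinor_flow F) (H\<^sub>0, h\<^sub>0) Tminus Tplus H h"
    then show thesis using that[of 1 "1 / 64"] by (simp add: flows)
  next
    assume "maximal_solution (normalized_spinor_flow n F) (H\<^sub>0, h\<^sub>0) Tminus Tplus H h"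
    then show thesis
      using that[of "2 / real n" "(real n - 1) / (32 * real n)"] n(1) by (simp add: flows)
  qed
  have sol: "solves_ivp (scaled_flow \<alpha> \<beta> F) (H\<^sub>0, h\<^sub>0) Tminus Tplus H h"
    using max by (simp add: maximal_solution_def)
  then have init: "(H 0, h 0) = (H\<^sub>0, h\<^sub>0)" by (simp add: solves_ivp_def)
  have "scaled_flow_solution \<alpha> \<beta> F Tminus Tplus H h"
    using sol pos by unfold_locales (auto simp: solves_ivp_def)
  from scaled_flow_solution.maximal_behaviour[OF this max[folded init] c] show ?thesis .
qed

end
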